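(* Let $d\ge1$, $\alpha\in(1,2)$, and let $(\mathbf{Z}_t)_{t\ge0}$ be the rotationally invariant $\alpha$-stable Lévy process on $\mathbb{R}^d$. Let $\mathbf{g}:\mathbb{R}^d\to\mathbb{R}^d$ be such that the solution $(\mathbf{X}_t^{\mathbf{x}})_{t\ge0}$ of the SDE $$\mathrm{d}\mathbf{X}_t^{\mathbf{x}}=\mathbf{g}(\mathbf{X}_t^{\mathbf{x}})\,\mathrm{d}t+\mathrm{d}\mathbf{Z}_t,\qquad \mathbf{X}_0=\mathbf{x}\in\mathbb{R}^d,$$ is ergodic with invariant probability measure $\pi$, and such that $\pi(\mathbf{g})=\int_{\mathbb{R}^d}\mathbf{g}(\mathbf{y})\,\pi(\mathrm{d}\mathbf{y})$ is finite (i.e. $\mathbf{g}$ is $\pi$-integrable). Then, for every $\mathbf{x}\in\mathbb{R}^d$, $$t^{-\frac1\alpha}\int_0^t[\mathbf{g}(\mathbf{X}_s^{\mathbf{x}})-\pi(\mathbf{g})]\,\mathrm{d}s\ \Rightarrow\ \mathbf{Z}_1\qquad\text{as }t\to\infty,$$ where $\Rightarrow$ denotes convergence in distribution and $\mathbf{Z}_1$ is the value of the process $\mathbf{Z}$ at time $1$.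
   Context: The rotationally invariant $\alpha$-stable process $(\mathbf{Z}_t)_{t\ge0}$ on $\mathbb{R}^d$ has Lévy measure $\nu(\mathrm{d}\mathbf{z})=C_{d,\alpha}|\mathbf{z}|^{-\alpha-d}\,\mathrm{d}\mathbf{z}$, $\nu(\{\mathbf{0}\})=0$, with $C_{d,\alpha}=\alpha 2^{\alpha-1}\pi^{-d/2}\frac{\Gamma((d+\alpha)/2)}{\Gamma(1-\alpha/2)}$; equivalently $\mathrm{d}\mathbf{Z}_t=\int_{|\mathbf{z}|>1}\mathbf{z}\,N(\mathrm{d}\mathbf{z},\mathrm{d}t)+\int_{|\mathbf{z}|\le1}\mathbf{z}\,\widetilde N(\mathrm{d}\mathbf{z},\mathrm{d}t)$, where $N$ is a Poisson random measure with intensity $\nu(\mathrm{d}\mathbf{z})\mathrm{d}t$ and $\widetilde N$ its compensation. A time-homogeneous Markov process $(\mathbf{X}_t^{\mathbf{x}})_{t\ge0}$ on $\mathbb{R}^d$ is called ergodic if there is a unique invariant probability measure $\pi$ such that $\lim_{t\to\infty}\|\mathcal{L}(\mathbf{X}_t^{\mathbf{x}})-\pi\|_{\mathrm{TV}}=0$ for all $\mathbf{x}\in\mathbb{R}^d$, where $\mathcal{L}(\cdot)$ denotes the law and $\|\cdot\|_{\mathrm{TV}}$ the total variation distance. *)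

theory Defs
  imports "HOL-Probability.Probability"
begin

text \<open>
  The state space \<open>\<real>\<^sup>d\<close> is a type of class \<open>euclidean_space\<close>, with \<open>d = DIM('a) \<ge> 1\<close>. Processes are
  functions of type \<open>real \<Rightarrow> 'w \<Rightarrow> 'a\<close>, of which only the values at times \<open>t \<ge> 0\<close> are used.
\<close>


section \<open>Stable Levy processes\<close>

definition cadlag :: "(real \<Rightarrow> 'a::topological_space) \<Rightarrow> bool" where
  "cadlag f \<longleftrightarrow>
     (\<forall>t\<ge>0. (f \<longlongrightarrow> f t) (at_right t)) \<and> (\<forall>t>0. \<exists>l. (f \<longlongrightarrow> l) (at_left t))"

text \<open>
  The library's \<open>filtration\<close> is indexed by the whole index type, here \<open>real\<close>. This is no restriction:
  a filtration on \<open>[0,\<infinity>)\<close> can be extended by its value at time \<open>0\<close>.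
\<close>

definition filtered_prob_space :: "'w measure \<Rightarrow> (real \<Rightarrow> 'w measure) \<Rightarrow> bool" where
  "filtered_prob_space M F \<longleftrightarrow>
     prob_space M \<and> filtration (space M) F \<and> (\<forall>t. subalgebra M (F t))"

definition adapted_process :: "(real \<Rightarrow> 'w measure) \<Rightarrow> (real \<Rightarrow> 'w \<Rightarrow> 'a::topological_space) \<Rightarrow> bool" where
  "adapted_process F Y \<longleftrightarrow> (\<forall>t\<ge>0. Y t \<in> borel_measurable (F t))"

definition levy_process ::
    "'w measure \<Rightarrow> (real \<Rightarrow> 'w measure) \<Rightarrow> (real \<Rightarrow> 'w \<Rightarrow> 'a::euclidean_space) \<Rightarrow> bool" where
  "levy_process M F Z \<longleftrightarrow>
     adapted_process F Z \<and>
     (AE \<omega> in M. Z 0 \<omega> = 0) \<and>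
     (\<forall>s t. 0 \<le> s \<longrightarrow> s \<le> t \<longrightarrow>
        prob_space.indep_set M (sets (F s))
          (sets (vimage_algebra (space M) (\<lambda>\<omega>. Z t \<omega> - Z s \<omega>) borel))) \<and>
     (\<forall>s t. 0 \<le> s \<longrightarrow> s \<le> t \<longrightarrow>
        distr M borel (\<lambda>\<omega>. Z t \<omega> - Z s \<omega>) = distr M borel (Z (t - s))) \<and>
     (AE \<omega> in M. cadlag (\<lambda>t. Z t \<omega>))"

text \<open>
  The Levy--Khintchine exponent of the triplet with no Gaussian part, Levy measure \<open>\<nu>\<close> and zero
  drift relative to the truncation function \<open>z \<mapsto> z 1(|z| \<le> 1)\<close>. It belongs to the process whose
  Levy--Ito decomposition consists of the jumps larger than \<open>1\<close> and the compensated jumps of size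
  at most \<open>1\<close> only.
\<close>

definition levy_exponent :: "'a::euclidean_space measure \<Rightarrow> 'a \<Rightarrow> complex" where
  "levy_exponent \<nu> u =
     (\<integral>z. (cis (u \<bullet> z) - 1 - \<i> * complex_of_real ((u \<bullet> z) * indicat_real (cball 0 1) z)) \<partial>\<nu>)"

definition pure_jump_levy_process ::
    "'w measure \<Rightarrow> (real \<Rightarrow> 'w measure) \<Rightarrow> 'a::euclidean_space measure \<Rightarrow>
      (real \<Rightarrow> 'w \<Rightarrow> 'a) \<Rightarrow> bool" where
  "pure_jump_levy_process M F \<nu> Z \<longleftrightarrow>
     levy_process M F Z \<and>
     (\<forall>t\<ge>0. \<forall>u. (\<integral>\<omega>. cis (u \<bullet> Z t \<omega>) \<partial>M) = exp (complex_of_real t * levy_exponent \<nu> u))"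

definition stable_const :: "nat \<Rightarrow> real \<Rightarrow> real" where
  "stable_const d \<alpha> =
     \<alpha> * 2 powr (\<alpha> - 1) * pi powr (- real d / 2) *
       (Gamma ((real d + \<alpha>) / 2) / Gamma (1 - \<alpha> / 2))"

definition stable_levy_measure :: "real \<Rightarrow> 'a::euclidean_space measure" where
  "stable_levy_measure \<alpha> =
     density lborel (\<lambda>z. ennreal (stable_const DIM('a) \<alpha> * norm z powr (- \<alpha> - real DIM('a))))"

definition rot_inv_stable_process ::
    "'w measure \<Rightarrow> (real \<Rightarrow> 'w measure) \<Rightarrow> real \<Rightarrow> (real \<Rightarrow> 'w \<Rightarrow> 'a::euclidean_space) \<Rightarrow> bool" where
  "rot_inv_stable_process M F \<alpha> Z \<longleftrightarrow> pure_jump_levy_process M F (stable_levy_measure \<alpha>) Z"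


section \<open>The stochastic differential equation\<close>

text \<open>
  Since the noise is additive, the equation is read in its integrated form. All paths of the
  solution are required to be cadlag (not only almost all), so that the time integrals of Borel
  functions along the solution are random variables even if \<open>M\<close> is not complete.
\<close>

definition sde_solution ::
    "'w measure \<Rightarrow> (real \<Rightarrow> 'w measure) \<Rightarrow> (real \<Rightarrow> 'w \<Rightarrow> 'a::euclidean_space) \<Rightarrow>
      ('a \<Rightarrow> 'a) \<Rightarrow> 'a \<Rightarrow> (real \<Rightarrow> 'w \<Rightarrow> 'a) \<Rightarrow> bool" where
  "sde_solution M F Z g x Y \<longleftrightarrow>
     adapted_process F Y \<and>
     (\<forall>\<omega>\<in>space M. cadlag (\<lambda>t. Y t \<omega>)) \<and>
     (AE \<omega> in M. \<forall>t\<ge>0.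
        set_integrable lborel {0..t} (\<lambda>s. g (Y s \<omega>)) \<and>
        Y t \<omega> = x + (LINT s:{0..t}|lborel. g (Y s \<omega>)) + Z t \<omega>)"


section \<open>Markov processes and ergodicity\<close>

text \<open>In the following, \<open>X x\<close> is the process started at \<open>x\<close>.\<close>

definition transition_law ::
    "'w measure \<Rightarrow> ('a \<Rightarrow> real \<Rightarrow> 'w \<Rightarrow> 'a::euclidean_space) \<Rightarrow> real \<Rightarrow> 'a \<Rightarrow> 'a measure" where
  "transition_law M X t x = distr M borel (X x t)"

definition natural_filtration ::
    "'w measure \<Rightarrow> (real \<Rightarrow> 'w \<Rightarrow> 'a::topological_space) \<Rightarrow> real \<Rightarrow> 'w measure" where
  "natural_filtration M Y s =
     sigma (space M) (\<Union>r\<in>{0..s}. {Y r -` B \<inter> space M | B. B \<in> sets borel})"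

definition markov_process ::
    "'w measure \<Rightarrow> ('a \<Rightarrow> real \<Rightarrow> 'w \<Rightarrow> 'a::euclidean_space) \<Rightarrow> bool" where
  "markov_process M X \<longleftrightarrow>
     (\<forall>x. \<forall>t\<ge>0. X x t \<in> borel_measurable M) \<and>
     (\<forall>x. AE \<omega> in M. X x 0 \<omega> = x) \<and>
     (\<forall>t\<ge>0. transition_law M X t \<in> borel \<rightarrow>\<^sub>M prob_algebra borel) \<and>
     (\<forall>x. \<forall>s\<ge>0. \<forall>t\<ge>0. \<forall>B\<in>sets borel.
        AE \<omega> in M.
          real_cond_exp M (natural_filtration M (X x) s) (\<lambda>\<omega>'. indicat_real B (X x (s + t) \<omega>')) \<omega>
            = measure (transition_law M X t (X x s \<omega>)) B)"

definition invariant_prob :: "(real \<Rightarrow> 'a \<Rightarrow> 'a::euclidean_space measure) \<Rightarrow> 'a measure \<Rightarrow> bool" where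
  "invariant_prob P \<pi> \<longleftrightarrow> \<pi> \<in> space (prob_algebra borel) \<and> (\<forall>t\<ge>0. \<pi> \<bind> P t = \<pi>)"

definition tv_dist :: "'a::topological_space measure \<Rightarrow> 'a measure \<Rightarrow> real" where
  "tv_dist \<mu> \<nu> = (SUP B\<in>sets borel. \<bar>measure \<mu> B - measure \<nu> B\<bar>)"

definition ergodic_with ::
    "'w measure \<Rightarrow> ('a \<Rightarrow> real \<Rightarrow> 'w \<Rightarrow> 'a::euclidean_space) \<Rightarrow> 'a measure \<Rightarrow> bool" where
  "ergodic_with M X \<pi> \<longleftrightarrow>
     markov_process M X \<and>
     invariant_prob (transition_law M X) \<pi> \<and>
     (\<forall>\<pi>'. invariant_prob (transition_law M X) \<pi>' \<longrightarrow> \<pi>' = \<pi>) \<and>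
     (\<forall>x. ((\<lambda>t. tv_dist (transition_law M X t x) \<pi>) \<longlongrightarrow> 0) at_top)"


section \<open>Convergence in distribution\<close>

text \<open>The library's \<open>weak_conv_m\<close> is confined to sequences of measures on the real line.\<close>

definition weakly_converges ::
    "('i \<Rightarrow> 'a::euclidean_space measure) \<Rightarrow> 'a measure \<Rightarrow> 'i filter \<Rightarrow> bool" where
  "weakly_converges \<mu> \<nu> G \<longleftrightarrow>
     (\<forall>f :: 'a \<Rightarrow> real. continuous_on UNIV f \<longrightarrow> bounded (range f) \<longrightarrow>
        ((\<lambda>i. \<integral>y. f y \<partial>\<mu> i) \<longlongrightarrow> (\<integral>y. f y \<partial>\<nu>)) G)"

definition converges_in_distribution ::
    "'w measure \<Rightarrow> ('i \<Rightarrow> 'w \<Rightarrow> 'a::euclidean_space) \<Rightarrow> ('w \<Rightarrow> 'a) \<Rightarrow> 'i filter \<Rightarrow> bool" where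
  "converges_in_distribution M Y W G \<longleftrightarrow>
     weakly_converges (\<lambda>i. distr M borel (Y i)) (distr M borel W) G"

end

theory Submission
  imports Defs "HOL-Real_Asymp.Real_Asymp"
begin

text \<open>
  The equation turns the additive functional into a difference: since
  \<open>X\<^sub>t = x + \<integral>\<^sub>0\<^sup>t g(X\<^sub>s) ds + Z\<^sub>t\<close>, the normalised integral equals
  \<open>t powr (- 1 / \<alpha>) (X\<^sub>t - x) - t powr (- 1 / \<alpha>) Z\<^sub>t - t powr (1 - 1 / \<alpha>) \<pi>(g)\<close>.

  The first term tends to \<open>0\<close> in probability, because the law of \<open>X\<^sub>t\<close> converges in total variation and
  so cannot charge the complements of balls of diverging radius
  (\<open>tv_convergent_negligible_at_diverging_scale\<close>). The second term has the law of \<open>Z\<^sub>1\<close> for every \<open>t > 0\<close>,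
  by self-similarity and symmetry (\<open>stable_self_similar\<close>); this follows from the homogeneity of the
  Levy--Khintchine exponent (\<open>stable_exponent_scaleR\<close>) and the uniqueness theorem for characteristic
  functions in several dimensions (\<open>char_function_uniqueness\<close>). A Slutsky argument
  (\<open>weakly_converges_perturbation\<close>) then gives the limit, provided that the third term is zero.

  That \<open>\<pi>(g) = 0\<close> is the remaining point (\<open>stationary_drift_inner_zero\<close>): started from \<open>\<pi>\<close>, the process
  does not move on average, while the equation says that its mean displacement in unit time is
  \<open>\<pi>(g) + E Z\<^sub>1\<close>. Here \<open>\<alpha> > 1\<close> enters: it makes \<open>Z\<^sub>1\<close> integrable (\<open>integrable_if_char_smooth_at_0\<close>), and its
  mean is \<open>0\<close> by symmetry. Two difficulties arise. As \<open>\<pi>\<close> may have no first moment, stationarity can only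
  be used for truncated coordinates (\<open>truncated_increment\<close>). And \<open>X\<close> is given for each starting point
  separately, with no measurability in the starting point, so the stationary process is not
  constructed; all averages over \<open>\<pi>\<close> are taken of integrals against the transition kernels, whose
  joint measurability in time and space follows from right continuity of the paths
  (\<open>kernel_jointly_measurable\<close>).
\<close>


section \<open>Scaling of the stable exponent\<close>

lemma lborel_integral_scaleR:
  fixes f :: "'a::euclidean_space \<Rightarrow> 'b::{banach, second_countable_topology}"
  assumes c: "c \<noteq> 0" and [measurable]: "f \<in> borel_measurable borel"
  shows "(\<integral>z. f z \<partial>lborel) = \<bar>c\<bar> ^ DIM('a) *\<^sub>R (\<integral>z. f (c *\<^sub>R z) \<partial>lborel)"
proof -
  have "(\<integral>z. f z \<partial>lborel)
      = (\<integral>z. f z \<partial>density (distr lborel borel (\<lambda>x. 0 + c *\<^sub>R x)) (\<lambda>_. ennreal (\<bar>c\<bar> ^ DIM('a))))"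
    using lborel_affine[OF c, of "0::'a"] by simp
  also have "\<dots> = (\<integral>z. \<bar>c\<bar> ^ DIM('a) *\<^sub>R f z \<partial>distr lborel borel (\<lambda>x. 0 + c *\<^sub>R x))"
    by (rule integral_density) auto
  also have "\<dots> = (\<integral>z. \<bar>c\<bar> ^ DIM('a) *\<^sub>R f (c *\<^sub>R z) \<partial>lborel)"
    by (subst integral_distr) auto
  finally show ?thesis by simp
qed

lemma lborel_integral_odd_eq_0:
  fixes f :: "'a::euclidean_space \<Rightarrow> 'b::{banach, second_countable_topology}"
  assumes "f \<in> borel_measurable borel" and odd: "\<And>z. f (- z) = - f z"
  shows "(\<integral>z. f z \<partial>lborel) = 0"
proof -
  have "(\<integral>z. f z \<partial>lborel) = - (\<integral>z. f z \<partial>lborel)"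
    using lborel_integral_scaleR[of "-1" f] assms by simp
  then have "2 *\<^sub>R (\<integral>z. f z \<partial>lborel) = 0"
    by (metis add.right_inverse scaleR_2)
  then show ?thesis by simp
qed

text \<open>
  If \<open>f\<close> is not integrable, then neither is \<open>f + k\<close>, and both integrals have the default value \<open>0\<close>.
\<close>
lemma integral_add_centred:
  fixes f k :: "'a \<Rightarrow> 'b::{banach, second_countable_topology}"
  assumes "integrable N k" and "(\<integral>z. k z \<partial>N) = 0"
  shows "(\<integral>z. f z + k z \<partial>N) = (\<integral>z. f z \<partial>N)"
proof (cases "integrable N f")
  case True
  then show ?thesis using assms by simp
next
  case False
  then have "\<not> integrable N (\<lambda>z. f z + k z)"
    using Bochner_Integration.integrable_diff[of N "\<lambda>z. f z + k z" k] assms(1) by auto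
  then show ?thesis using False by (simp add: not_integrable_integral_eq)
qed

lemma stable_const_pos:
  assumes "0 < \<alpha>" "\<alpha> < 2"
  shows "0 < stable_const d \<alpha>"
  unfolding stable_const_def using assms by (intro mult_pos_pos divide_pos_pos Gamma_real_pos) auto

text \<open>
  The substitution \<open>z \<mapsto> c z\<close> reproduces the homogeneous density of the stable measure up to a factor,
  but it also turns the truncation at radius \<open>1\<close> into a truncation at radius \<open>\<bar>c\<bar>\<close>. By symmetry of the
  measure this does not change the integral. No drift appears, and the case \<open>c = - 1\<close> says that the
  process is symmetric.
\<close>
lemma stable_exponent_scaleR:
  fixes u :: "'a::euclidean_space"
  assumes \<alpha>: "0 < \<alpha>" "\<alpha> < 2" and c: "c \<noteq> 0"
  shows "levy_exponent (stable_levy_measure \<alpha>) (c *\<^sub>R u)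
       = of_real (\<bar>c\<bar> powr \<alpha>) * levy_exponent (stable_levy_measure \<alpha>) u"
proof -
  define p :: "'a \<Rightarrow> real" where
    "p z = stable_const DIM('a) \<alpha> * norm z powr (- \<alpha> - real DIM('a))" for z
  define h :: "real \<Rightarrow> 'a \<Rightarrow> 'a \<Rightarrow> complex" where
    "h r v z = p z *\<^sub>R (cis (v \<bullet> z) - 1 - \<i> * complex_of_real ((v \<bullet> z) * indicat_real (cball 0 r) z))"
    for r v z
  have p_nonneg: "0 \<le> p z" for z
    unfolding p_def using stable_const_pos[OF \<alpha>, of "DIM('a)"] by simp
  have [measurable]: "p \<in> borel_measurable borel" unfolding p_def by measurable
  have [measurable]: "cball (0::'a) r \<in> sets borel" for r by simp
  have [measurable]: "h r v \<in> borel_measurable borel" for r v unfolding h_def cis_conv_exp by measurable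
  have exponent: "levy_exponent (stable_levy_measure \<alpha>) v = (\<integral>z. h 1 v z \<partial>lborel)" for v :: 'a
    unfolding levy_exponent_def stable_levy_measure_def h_def p_def[symmetric]
    by (rule integral_density) (auto simp: p_nonneg cis_conv_exp)
  \<comment> \<open>The radius of the truncation is immaterial: changing it adds the integral of an odd function
    that is bounded and supported in an annulus.\<close>
  have truncation: "(\<integral>z. h r u z \<partial>lborel) = (\<integral>z. h 1 u z \<partial>lborel)" if r: "0 < r" for r
  proof -
    define k :: "'a \<Rightarrow> complex" where
      "k z = p z *\<^sub>R (\<i> * complex_of_real ((u \<bullet> z) *
          (indicat_real (cball 0 1) z - indicat_real (cball 0 r) z)))" for z
    define B where "B = p (min r 1 *\<^sub>R (SOME b. b \<in> Basis)) * (norm u * max r 1)"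
    have [measurable]: "k \<in> borel_measurable borel" unfolding k_def by measurable
    have "norm (SOME b::'a. b \<in> Basis) = 1" by (simp add: some_in_eq SOME_Basis)
    then have p_min: "p (min r 1 *\<^sub>R (SOME b. b \<in> Basis))
        = stable_const DIM('a) \<alpha> * min r 1 powr (- \<alpha> - real DIM('a))"
      unfolding p_def using r by simp
    have "norm (k z) \<le> norm (indicat_real (cball 0 (max r 1)) z *\<^sub>R B)" for z
    proof (cases "min r 1 \<le> norm z \<and> norm z \<le> max r 1")
      case True
      have "norm z powr (- \<alpha> - real DIM('a)) \<le> min r 1 powr (- \<alpha> - real DIM('a))"
        using True r \<alpha> by (intro powr_mono2') auto
      then have p_le: "p z \<le> p (min r 1 *\<^sub>R (SOME b. b \<in> Basis))"
        unfolding p_min unfolding p_def using stable_const_pos[OF \<alpha>, of "DIM('a)"]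
        by (intro mult_left_mono) auto
      have "norm (k z) = p z * (\<bar>u \<bullet> z\<bar> * \<bar>indicat_real (cball 0 1) z - indicat_real (cball 0 r) z\<bar>)"
        unfolding k_def by (auto simp: norm_mult abs_mult p_nonneg indicator_def)
      also have "\<bar>u \<bullet> z\<bar> * \<bar>indicat_real (cball 0 1) z - indicat_real (cball 0 r) z\<bar>
          \<le> (norm u * max r 1) * 1"
      proof (rule mult_mono)
        have "\<bar>u \<bullet> z\<bar> \<le> norm u * norm z" by (rule Cauchy_Schwarz_ineq2)
        also have "\<dots> \<le> norm u * max r 1" using True by (intro mult_left_mono) auto
        finally show "\<bar>u \<bullet> z\<bar> \<le> norm u * max r 1" .
      qed (auto simp: indicator_def)
      finally have "norm (k z) \<le> p z * (norm u * max r 1)"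
        using p_nonneg[of z] by (simp add: mult_left_mono)
      also have "\<dots> \<le> B" unfolding B_def using p_le r by (intro mult_right_mono) auto
      finally show ?thesis using True by simp
    next
      case False
      then have "k z = 0" unfolding k_def by (auto simp: indicator_def)
      then show ?thesis by simp
    qed
    then have k_le: "AE z in lborel. norm (k z) \<le> norm (indicat_real (cball 0 (max r 1)) z *\<^sub>R B)"
      by simp
    have "integrable lborel (\<lambda>z::'a. indicat_real (cball 0 (max r 1)) z *\<^sub>R B)"
      using emeasure_bounded_finite[OF bounded_cball[of "0::'a" "max r 1"]]
      by (intro integrable_scaleR_left integrable_real_indicator) auto
    from Bochner_Integration.integrable_bound[OF this _ k_le] have "integrable lborel k"
      by simp
    moreover have "(\<integral>z. k z \<partial>lborel) = 0"
      by (rule lborel_integral_odd_eq_0) (auto simp: k_def p_def indicator_def)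
    moreover have "h r u z = h 1 u z + k z" for z
      unfolding h_def k_def by (simp add: algebra_simps scaleR_conv_of_real)
    ultimately show ?thesis by (simp add: integral_add_centred)
  qed
  have "h \<bar>c\<bar> u (c *\<^sub>R z) = \<bar>c\<bar> powr (- \<alpha> - real DIM('a)) *\<^sub>R h 1 (c *\<^sub>R u) z" for z
  proof -
    have "indicat_real (cball 0 \<bar>c\<bar>) (c *\<^sub>R z) = indicat_real (cball 0 1) z"
      using c by (simp add: indicator_def)
    then show ?thesis unfolding h_def p_def by (simp add: powr_mult)
  qed
  then have "(\<integral>z. h \<bar>c\<bar> u z \<partial>lborel)
      = (\<bar>c\<bar> ^ DIM('a) * \<bar>c\<bar> powr (- \<alpha> - real DIM('a))) *\<^sub>R (\<integral>z. h 1 (c *\<^sub>R u) z \<partial>lborel)"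
    by (subst lborel_integral_scaleR[OF c]) auto
  also have "\<bar>c\<bar> ^ DIM('a) * \<bar>c\<bar> powr (- \<alpha> - real DIM('a)) = inverse (\<bar>c\<bar> powr \<alpha>)"
    using c by (simp add: powr_realpow[symmetric] powr_add[symmetric] powr_minus[symmetric])
  finally have "(\<integral>z. h 1 (c *\<^sub>R u) z \<partial>lborel) = \<bar>c\<bar> powr \<alpha> *\<^sub>R (\<integral>z. h \<bar>c\<bar> u z \<partial>lborel)"
    using c by simp
  then show ?thesis
    using c truncation[of "\<bar>c\<bar>"] by (simp add: exponent scaleR_conv_of_real)
qed


section \<open>Characteristic functions determine laws\<close>

lemma integrable_scaleR_cis:
  fixes w :: "'b \<Rightarrow> real"
  assumes "finite_measure M" and [measurable]: "w \<in> borel_measurable M" "Y \<in> borel_measurable M"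
    and w: "\<And>x. \<bar>w x\<bar> \<le> K"
  shows "integrable M (\<lambda>x. w x *\<^sub>R cis (Y x))"
proof -
  interpret finite_measure M by fact
  show ?thesis
    using w by (intro integrable_const_bound[of _ K]) (auto simp: cis_conv_exp)
qed

lemma integrable_cis:
  assumes "finite_measure M" "Y \<in> borel_measurable M"
  shows "integrable M (\<lambda>x. cis (Y x))"
  using integrable_scaleR_cis[of M "\<lambda>_. 1" Y 1] assms by simp

text \<open>
  After normalisation the weights are probability densities, so this is the uniqueness theorem for
  characteristic functions on the line, applied to the laws of \<open>Y\<close> and \<open>Y'\<close> under the reweighted
  measures.
\<close>
lemma integral_weighted_indicator_eqI:
  fixes v :: "'b \<Rightarrow> real" and Y :: "'b \<Rightarrow> real"
  assumes "finite_measure M" "finite_measure N"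
    and [measurable]: "v \<in> borel_measurable M" "Y \<in> borel_measurable M"
      "v' \<in> borel_measurable N" "Y' \<in> borel_measurable N"
    and v: "\<And>x. 0 \<le> v x" "\<And>x. v x \<le> K" "\<And>x. 0 \<le> v' x" "\<And>x. v' x \<le> K"
    and pos: "0 < (\<integral>x. v x \<partial>M)"
    and weighted: "\<And>r. (\<integral>x. v x *\<^sub>R cis (r * Y x) \<partial>M) = (\<integral>x. v' x *\<^sub>R cis (r * Y' x) \<partial>N)"
    and A[measurable]: "A \<in> sets borel"
  shows "(\<integral>x. v x * indicat_real A (Y x) \<partial>M) = (\<integral>x. v' x * indicat_real A (Y' x) \<partial>N)"
proof -
  define m where "m = (\<integral>x. v x \<partial>M)"
  have m: "m = (\<integral>x. v' x \<partial>N)"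
    using weighted[of 0] unfolding m_def by (simp add: scaleR_conv_of_real)
  have "0 < m" using pos by (simp add: m_def)
  let ?D = "\<lambda>M v (Y :: _ \<Rightarrow> real). distr (density M (\<lambda>x. ennreal (v x / m))) borel Y"
  have D: "real_distribution (?D M v Y)
      \<and> (\<forall>r. char (?D M v Y) r = (\<integral>x. v x *\<^sub>R cis (r * Y x) \<partial>M) /\<^sub>R m)
      \<and> (\<forall>A\<in>sets borel. measure (?D M v Y) A = (\<integral>x. v x * indicat_real A (Y x) \<partial>M) / m)"
    if "finite_measure M" and [measurable]: "v \<in> borel_measurable M" "Y \<in> borel_measurable M"
      and v: "\<And>x. 0 \<le> v x" "\<And>x. v x \<le> K" and m: "m = (\<integral>x. v x \<partial>M)"
    for M :: "'d measure" and v Y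
  proof (intro conjI allI ballI)
    interpret finite_measure M by fact
    have int: "integrable M v"
      using v by (intro integrable_const_bound[of _ K]) auto
    have "emeasure (density M (\<lambda>x. ennreal (v x / m))) (space M) = (\<integral>\<^sup>+x. ennreal (v x / m) \<partial>M)"
      by (subst emeasure_density) (auto intro!: nn_integral_cong)
    also have "\<dots> = ennreal (\<integral>x. v x / m \<partial>M)"
      using v \<open>0 < m\<close> int by (intro nn_integral_eq_integral) auto
    also have "\<dots> = 1" using \<open>0 < m\<close> by (simp add: m)
    finally interpret P: prob_space "density M (\<lambda>x. ennreal (v x / m))"
      by (intro prob_spaceI) simp
    interpret R: real_distribution "?D M v Y"
      by (rule P.real_distribution_distr) simp
    show "real_distribution (?D M v Y)" by unfold_locales
    show "char (?D M v Y) r = (\<integral>x. v x *\<^sub>R cis (r * Y x) \<partial>M) /\<^sub>R m" for r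
    proof -
      have "char (?D M v Y) r = (\<integral>x. iexp (r * Y x) \<partial>density M (\<lambda>x. ennreal (v x / m)))"
        unfolding char_def by (subst integral_distr) auto
      also have "\<dots> = (\<integral>x. (v x / m) *\<^sub>R iexp (r * Y x) \<partial>M)"
        using v \<open>0 < m\<close> by (intro integral_density) auto
      also have "\<dots> = (\<integral>x. inverse m *\<^sub>R (v x *\<^sub>R cis (r * Y x)) \<partial>M)"
        by (intro Bochner_Integration.integral_cong) (auto simp: cis_conv_exp field_simps)
      finally show ?thesis by (simp only: integral_scaleR_right)
    qed
    show "measure (?D M v Y) A = (\<integral>x. v x * indicat_real A (Y x) \<partial>M) / m"
      if [measurable]: "A \<in> sets borel" for A
    proof -
      have "measure (?D M v Y) A = (\<integral>y. indicat_real A y \<partial>?D M v Y)"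
        by simp
      also have "\<dots> = (\<integral>x. indicat_real A (Y x) \<partial>density M (\<lambda>x. ennreal (v x / m)))"
        by (subst integral_distr) auto
      also have "\<dots> = (\<integral>x. (v x / m) *\<^sub>R indicat_real A (Y x) \<partial>M)"
        using v \<open>0 < m\<close> by (intro integral_density) auto
      finally show ?thesis by simp
    qed
  qed
  note DM = D[OF assms(1,3,4) v(1,2) m_def] and DN = D[OF assms(2,5,6) v(3,4) m]
  have "?D M v Y = ?D N v' Y'"
    using DM DN weighted by (intro Levy_uniqueness) (auto simp: fun_eq_iff)
  then show ?thesis
    using DM DN A \<open>0 < m\<close> by (metis (no_types, lifting) div_by_0 divide_cancel_right less_irrefl)
qed

text \<open>
  A signed weight \<open>w\<close> with values in \<open>[-1, 1]\<close> becomes a positive one, with total mass at least \<open>1\<close>, by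
  adding \<open>2\<close>. The contribution of the constant \<open>2\<close> is then subtracted; it is the case of weight \<open>1\<close>.
\<close>
lemma integral_signed_weighted_indicator_eqI:
  fixes w :: "'b \<Rightarrow> real" and Y :: "'b \<Rightarrow> real"
  assumes M: "prob_space M" and N: "prob_space N"
    and [measurable]: "w \<in> borel_measurable M" "Y \<in> borel_measurable M"
      "w' \<in> borel_measurable N" "Y' \<in> borel_measurable N"
    and w: "\<And>x. \<bar>w x\<bar> \<le> 1" "\<And>x. \<bar>w' x\<bar> \<le> 1"
    and char_eq: "\<And>r. (\<integral>x. cis (r * Y x) \<partial>M) = (\<integral>x. cis (r * Y' x) \<partial>N)"
    and weighted: "\<And>r. (\<integral>x. w x *\<^sub>R cis (r * Y x) \<partial>M) = (\<integral>x. w' x *\<^sub>R cis (r * Y' x) \<partial>N)"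
    and A[measurable]: "A \<in> sets borel"
  shows "(\<integral>x. w x * indicat_real A (Y x) \<partial>M) = (\<integral>x. w' x * indicat_real A (Y' x) \<partial>N)"
proof -
  interpret M: prob_space M by fact
  interpret N: prob_space N by fact
  have int: "integrable M w" "integrable N w'"
    "integrable M (\<lambda>x. w x * indicat_real A (Y x))" "integrable N (\<lambda>x. w' x * indicat_real A (Y' x))"
    "integrable M (\<lambda>x. indicat_real A (Y x))" "integrable N (\<lambda>x. indicat_real A (Y' x))"
    using w by (auto intro!: M.integrable_const_bound[of _ 1] N.integrable_const_bound[of _ 1]
        simp: abs_mult indicator_def)
  have w': "- 1 \<le> w x" "w x \<le> 1" "- 1 \<le> w' y" "w' y \<le> 1" for x y
    using w(1)[of x] w(2)[of y] by auto
  have intc: "integrable M (\<lambda>x. w x *\<^sub>R cis (r * Y x))" "integrable N (\<lambda>x. w' x *\<^sub>R cis (r * Y' x))"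
    "integrable M (\<lambda>x. cis (r * Y x))" "integrable N (\<lambda>x. cis (r * Y' x))" for r
    using w by (auto intro!: integrable_scaleR_cis[where K = 1] integrable_cis
        M.finite_measure_axioms N.finite_measure_axioms)
  have one: "(\<integral>x. 1 * indicat_real A (Y x) \<partial>M) = (\<integral>x. 1 * indicat_real A (Y' x) \<partial>N)"
    using char_eq
    by (intro integral_weighted_indicator_eqI[where K = 1])
       (auto simp: M.finite_measure_axioms N.finite_measure_axioms M.prob_space)
  have "(\<integral>x. - 1 \<partial>M) \<le> (\<integral>x. w x \<partial>M)"
    using int w' by (intro integral_mono) auto
  then have pos: "0 < (\<integral>x. 2 + w x \<partial>M)"
    using int by (simp add: M.prob_space)
  have "(\<integral>x. (2 + w x) * indicat_real A (Y x) \<partial>M) = (\<integral>x. (2 + w' x) * indicat_real A (Y' x) \<partial>N)"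
  proof (rule integral_weighted_indicator_eqI[where K = 3])
    show "(\<integral>x. (2 + w x) *\<^sub>R cis (r * Y x) \<partial>M) = (\<integral>x. (2 + w' x) *\<^sub>R cis (r * Y' x) \<partial>N)" for r
      using intc char_eq weighted by (simp add: scaleR_add_left)
    show "0 \<le> 2 + w x" "2 + w x \<le> 3" "0 \<le> 2 + w' y" "2 + w' y \<le> 3" for x y
      using w'(1)[of x] w'(2)[of x] w'(3)[of y] w'(4)[of y] by auto
  qed (use pos in \<open>auto simp: M.finite_measure_axioms N.finite_measure_axioms\<close>)
  then show ?thesis
    using int one by (simp add: distrib_right)
qed

text \<open>
  The one-dimensional theorem is used one coordinate at a time. For a set \<open>B\<close> of basis vectors, the
  induction shows that the Fourier transforms of the two measures agree after restriction to the
  slab given by the coordinates in \<open>B\<close>. To add a coordinate \<open>b\<close>, the real and imaginary parts of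
  \<open>z \<mapsto> cis (u \<bullet> z)\<close> on the slab serve as signed weights: multiplied by \<open>cis (r * (b \<bullet> z))\<close> they are
  combinations of exponentials again, so the weighted one-dimensional transforms in direction \<open>b\<close>
  agree. When \<open>B\<close> is the whole basis, \<open>u = 0\<close> gives the measures of all boxes.
\<close>
lemma char_function_uniqueness:
  fixes \<mu> \<nu> :: "'a::euclidean_space measure"
  assumes \<mu>: "prob_space \<mu>" "sets \<mu> = sets borel" and \<nu>: "prob_space \<nu>" "sets \<nu> = sets borel"
    and char_eq: "\<And>u. (\<integral>z. cis (u \<bullet> z) \<partial>\<mu>) = (\<integral>z. cis (u \<bullet> z) \<partial>\<nu>)"
  shows "\<mu> = \<nu>"
proof -
  interpret \<mu>: prob_space \<mu> by fact
  interpret \<nu>: prob_space \<nu> by fact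
  have [measurable_cong]: "sets \<mu> = sets borel" "sets \<nu> = sets borel" by fact+
  define S where "S B a c = {z::'a. \<forall>b\<in>B. a \<bullet> b < z \<bullet> b \<and> z \<bullet> b < c \<bullet> b}" for B a c
  have slab: "(\<integral>z. indicat_real (S B a c) z *\<^sub>R cis (u \<bullet> z) \<partial>\<mu>)
      = (\<integral>z. indicat_real (S B a c) z *\<^sub>R cis (u \<bullet> z) \<partial>\<nu>)"
    if "finite B" for B a c u
    using that
  proof (induction B arbitrary: u)
    case empty
    then show ?case using char_eq by (simp add: S_def)
  next
    case (insert b B)
    have [measurable]: "S B a c \<in> sets borel"
    proof -
      have "S B a c = (\<Inter>b\<in>B. {z. a \<bullet> b < z \<bullet> b} \<inter> {z. z \<bullet> b < c \<bullet> b}) \<inter> space borel"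
        unfolding S_def by auto
      then show ?thesis using insert.hyps
        by (cases "B = {}") auto
    qed
    let ?I = "\<lambda>z. indicat_real (S B a c) z"
    let ?A = "{a \<bullet> b<..<c \<bullet> b}"
    have int: "integrable \<mu> (\<lambda>z. ?I z *\<^sub>R cis (u \<bullet> z))" "integrable \<nu> (\<lambda>z. ?I z *\<^sub>R cis (u \<bullet> z))" for u
      by (auto intro!: integrable_scaleR_cis[where K = 1] \<mu>.finite_measure_axioms \<nu>.finite_measure_axioms
          simp: indicator_def)
    have char_b: "(\<integral>z. cis (r * (b \<bullet> z)) \<partial>\<mu>) = (\<integral>z. cis (r * (b \<bullet> z)) \<partial>\<nu>)" for r
      using char_eq[of "r *\<^sub>R b"] by simp
    have cos_part: "(?I z * cos (u \<bullet> z)) *\<^sub>R cis (r * (b \<bullet> z))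
        = (1/2) *\<^sub>R (?I z *\<^sub>R cis ((u + r *\<^sub>R b) \<bullet> z) + ?I z *\<^sub>R cis ((r *\<^sub>R b - u) \<bullet> z))" for r z
      by (simp add: complex_eq_iff inner_left_distrib inner_diff_left cos_add cos_diff sin_add sin_diff algebra_simps)
    have sin_part: "(?I z * sin (u \<bullet> z)) *\<^sub>R cis (r * (b \<bullet> z))
        = (\<i> / 2) * (?I z *\<^sub>R cis ((r *\<^sub>R b - u) \<bullet> z) - ?I z *\<^sub>R cis ((u + r *\<^sub>R b) \<bullet> z))" for r z
      by (simp add: complex_eq_iff inner_left_distrib inner_diff_left cos_add cos_diff sin_add sin_diff algebra_simps add_divide_distrib diff_divide_distrib)
    have "(\<integral>z. (?I z * cos (u \<bullet> z)) * indicat_real ?A (b \<bullet> z) \<partial>\<mu>)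
        = (\<integral>z. (?I z * cos (u \<bullet> z)) * indicat_real ?A (b \<bullet> z) \<partial>\<nu>)"
    proof (rule integral_signed_weighted_indicator_eqI[OF \<mu>(1) \<nu>(1)])
      show "(\<integral>z. (?I z * cos (u \<bullet> z)) *\<^sub>R cis (r * (b \<bullet> z)) \<partial>\<mu>)
          = (\<integral>z. (?I z * cos (u \<bullet> z)) *\<^sub>R cis (r * (b \<bullet> z)) \<partial>\<nu>)" for r
        unfolding cos_part using int insert.IH by simp
      show "\<bar>?I z * cos (u \<bullet> z)\<bar> \<le> 1" "\<bar>?I z * cos (u \<bullet> z)\<bar> \<le> 1" for z
        by (simp_all add: indicator_def)
    qed (use char_b in simp_all)
    moreover have "(\<integral>z. (?I z * sin (u \<bullet> z)) * indicat_real ?A (b \<bullet> z) \<partial>\<mu>)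
        = (\<integral>z. (?I z * sin (u \<bullet> z)) * indicat_real ?A (b \<bullet> z) \<partial>\<nu>)"
    proof (rule integral_signed_weighted_indicator_eqI[OF \<mu>(1) \<nu>(1)])
      show "(\<integral>z. (?I z * sin (u \<bullet> z)) *\<^sub>R cis (r * (b \<bullet> z)) \<partial>\<mu>)
          = (\<integral>z. (?I z * sin (u \<bullet> z)) *\<^sub>R cis (r * (b \<bullet> z)) \<partial>\<nu>)" for r
        unfolding sin_part using int insert.IH by simp
      show "\<bar>?I z * sin (u \<bullet> z)\<bar> \<le> 1" "\<bar>?I z * sin (u \<bullet> z)\<bar> \<le> 1" for z
        by (simp_all add: indicator_def)
    qed (use char_b in simp_all)
    moreover have "(\<integral>z. indicat_real (S (insert b B) a c) z *\<^sub>R cis (u \<bullet> z) \<partial>\<rho>)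
        = Complex (\<integral>z. (?I z * cos (u \<bullet> z)) * indicat_real ?A (b \<bullet> z) \<partial>\<rho>)
            (\<integral>z. (?I z * sin (u \<bullet> z)) * indicat_real ?A (b \<bullet> z) \<partial>\<rho>)"
      if "finite_measure \<rho>" and [measurable_cong]: "sets \<rho> = sets borel" for \<rho>
    proof -
      have ind: "indicat_real (S (insert b B) a c) z = ?I z * indicat_real ?A (b \<bullet> z)" for z
        by (auto simp: S_def indicator_def inner_commute)
      have "integrable \<rho> (\<lambda>z. (?I z * indicat_real ?A (b \<bullet> z)) *\<^sub>R cis (u \<bullet> z))"
        by (auto intro!: integrable_scaleR_cis[where K = 1] that simp: indicator_def)
      from integral_Re[OF this] integral_Im[OF this] show ?thesis
        unfolding ind by (simp add: complex_eq_iff ac_simps)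
    qed
    ultimately show ?case
      using \<mu>.finite_measure_axioms \<nu>.finite_measure_axioms \<mu>(2) \<nu>(2) by simp
  qed
  have box_eq: "emeasure \<mu> (box a c) = emeasure \<nu> (box a c)" for a c
  proof -
    have "S Basis a c = box a c" by (auto simp: S_def box_def)
    then have "complex_of_real (measure \<mu> (box a c)) = complex_of_real (measure \<nu> (box a c))"
      using slab[of Basis a c 0] by (simp add: scaleR_conv_of_real)
    then show ?thesis by (simp add: \<mu>.emeasure_eq_measure \<nu>.emeasure_eq_measure)
  qed
  show ?thesis
  proof (rule measure_eqI_generator_eq)
    show "Int_stable (range (\<lambda>(a::'a, c). box a c))"
      by (auto simp: Int_stable_def box_Int_box)
    show "(\<Union>n. box (- (real n *\<^sub>R One)) (real n *\<^sub>R One)) = (UNIV::'a set)"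
      by (rule UN_box_eq_UNIV)
    show "range (\<lambda>n. box (- (real n *\<^sub>R One)) (real n *\<^sub>R One)) \<subseteq> range (\<lambda>(a::'a, c). box a c)"
      by auto
    show "emeasure \<mu> B = emeasure \<nu> B" if "B \<in> range (\<lambda>(a::'a, c). box a c)" for B
      using that box_eq by auto
    show "sets \<mu> = sigma_sets UNIV (range (\<lambda>(a, c). box a c))"
      "sets \<nu> = sigma_sets UNIV (range (\<lambda>(a, c). box a c))"
      unfolding \<mu>(2) \<nu>(2) borel_eq_box by simp_all
  qed simp_all
qed


section \<open>Self-similarity and first moment of the stable process\<close>

text \<open>
  If \<open>2 ^ k \<le> \<bar>y\<bar> < 2 ^ Suc k\<close>, then \<open>\<bar>y\<bar> / 2 ^ k\<close> lies in \<open>[1, 2)\<close>, where \<open>1 - cos\<close> is at least \<open>1 - cos 1\<close>;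
  so a single term of the series already dominates \<open>\<bar>y\<bar>\<close>.
\<close>
lemma abs_le_dyadic_cos_sum:
  fixes y :: real
  shows "ennreal \<bar>y\<bar>
    \<le> 1 + ennreal (2 / (1 - cos 1)) * (\<Sum>k. ennreal (2 ^ k * (1 - cos (y / 2 ^ k))))"
proof (cases "\<bar>y\<bar> < 1")
  case True
  then have "ennreal \<bar>y\<bar> \<le> 1" using ennreal_leI[of "\<bar>y\<bar>" 1] by simp
  then show ?thesis by (rule order_trans) simp
next
  case False
  obtain n where "\<bar>y\<bar> < 2 ^ n" using real_arch_pow[of 2 "\<bar>y\<bar>"] by auto
  then obtain m where m: "\<bar>y\<bar> < 2 ^ m" "\<And>j. j < m \<Longrightarrow> \<not> \<bar>y\<bar> < 2 ^ j"
    using exists_least_iff[of "\<lambda>n. \<bar>y\<bar> < 2 ^ n"] by blast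
  obtain k where k: "m = Suc k" using m(1) False by (cases m) auto
  have y: "2 ^ k \<le> \<bar>y\<bar>" "\<bar>y\<bar> < 2 * 2 ^ k" using m(1) m(2)[of k] k by auto
  have "1 < pi" "2 < pi" using pi_gt3 by auto
  then have "cos 1 < (1::real)" using cos_monotone_0_pi[of 0 1] by simp
  have "cos (y / 2 ^ k) = cos (\<bar>y\<bar> / 2 ^ k)"
    using cos_abs_real[of "y / 2 ^ k"] by simp
  also have "\<dots> \<le> cos 1"
  proof (rule cos_monotone_0_pi_le)
    show "\<bar>y\<bar> / 2 ^ k \<le> pi"
    proof (rule order_trans)
      show "\<bar>y\<bar> / 2 ^ k \<le> 2" using y(2) by (simp add: field_simps)
    qed (use \<open>2 < pi\<close> in simp)
  qed (use y(1) in \<open>auto simp: field_simps\<close>)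
  finally have "2 ^ k * (1 - cos 1) \<le> 2 ^ k * (1 - cos (y / 2 ^ k))"
    by (intro mult_left_mono) auto
  then have "2 / (1 - cos 1) * (2 ^ k * (1 - cos 1)) \<le> 2 / (1 - cos 1) * (2 ^ k * (1 - cos (y / 2 ^ k)))"
    using \<open>cos 1 < (1::real)\<close> by (intro mult_left_mono) auto
  then have "\<bar>y\<bar> \<le> 2 / (1 - cos 1) * (2 ^ k * (1 - cos (y / 2 ^ k)))"
    using y(2) \<open>cos 1 < (1::real)\<close> by simp
  then have "ennreal \<bar>y\<bar> \<le> ennreal (2 / (1 - cos 1)) * ennreal (2 ^ k * (1 - cos (y / 2 ^ k)))"
    using \<open>cos 1 < (1::real)\<close> by (subst ennreal_mult[symmetric]) (auto intro: ennreal_leI)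
  also have "ennreal (2 ^ k * (1 - cos (y / 2 ^ k))) \<le> (\<Sum>k. ennreal (2 ^ k * (1 - cos (y / 2 ^ k))))"
  proof -
    define f where "f = (\<lambda>k. ennreal (2 ^ k * (1 - cos (y / 2 ^ k))))"
    have "sum f {k} \<le> suminf f" by (rule sum_le_suminf) auto
    then show ?thesis by (simp add: f_def)
  qed
  finally show ?thesis by (rule order_trans) (simp_all add: mult_left_mono)
qed

text \<open>
  A law has a finite first moment if the real part of its characteristic function at the points
  \<open>r = 1 / 2 ^ k\<close> deviates from \<open>1\<close> by \<open>O(r powr \<alpha>)\<close> with \<open>\<alpha> > 1\<close>: after taking expectations in the dyadic bound for \<open>\<bar>y\<bar>\<close>, the series is geometric with
  ratio \<open>2 powr (1 - \<alpha>) < 1\<close>.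
\<close>
lemma integrable_if_char_smooth_at_0:
  fixes Y :: "'b \<Rightarrow> real"
  assumes "prob_space M" and [measurable]: "Y \<in> borel_measurable M"
    and \<alpha>: "1 < \<alpha>"
    and bound: "\<And>k::nat. (\<integral>\<omega>. 1 - cos (Y \<omega> / 2 ^ k) \<partial>M) \<le> C * (1 / 2 ^ k) powr \<alpha>"
  shows "integrable M Y"
proof -
  interpret prob_space M by fact
  define q where "q = 2 powr (1 - \<alpha>)"
  have q: "0 \<le> q" "q < 1" unfolding q_def using \<alpha> by (auto simp: powr_less_one)
  have "0 \<le> (\<integral>\<omega>. 1 - cos (Y \<omega> / 2 ^ 0) \<partial>M)"
    by (rule Bochner_Integration.integral_nonneg) simp
  also note bound[of 0]
  finally have C: "0 \<le> C" by simp
  have term_le: "(\<integral>\<^sup>+\<omega>. ennreal (2 ^ k * (1 - cos (Y \<omega> / 2 ^ k))) \<partial>M) \<le> ennreal (C * q ^ k)" for k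
  proof -
    have "\<bar>1 - cos (Y \<omega> / 2 ^ k)\<bar> \<le> 2" for \<omega>
      using cos_ge_minus_one[of "Y \<omega> / 2 ^ k"] cos_le_one[of "Y \<omega> / 2 ^ k"] by (simp add: abs_le_iff)
    then have "integrable M (\<lambda>\<omega>. 1 - cos (Y \<omega> / 2 ^ k))"
      by (intro integrable_const_bound[of _ 2]) simp_all
    then have "(\<integral>\<^sup>+\<omega>. ennreal (2 ^ k * (1 - cos (Y \<omega> / 2 ^ k))) \<partial>M)
        = ennreal (2 ^ k * (\<integral>\<omega>. 1 - cos (Y \<omega> / 2 ^ k) \<partial>M))"
      by (subst nn_integral_eq_integral) auto
    also have "\<dots> \<le> ennreal (2 ^ k * (C * (1 / 2 ^ k) powr \<alpha>))"
      using bound by (intro ennreal_leI mult_left_mono) auto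
    also have "2 ^ k * (C * (1 / 2 ^ k) powr \<alpha>) = C * q ^ k"
      by (simp add: q_def powr_divide powr_diff powr_powr powr_realpow[symmetric] power_divide
          mult.commute)
    finally show ?thesis .
  qed
  have "(\<integral>\<^sup>+\<omega>. ennreal \<bar>Y \<omega>\<bar> \<partial>M)
      \<le> (\<integral>\<^sup>+\<omega>. 1 + ennreal (2 / (1 - cos 1)) * (\<Sum>k. ennreal (2 ^ k * (1 - cos (Y \<omega> / 2 ^ k)))) \<partial>M)"
    by (intro nn_integral_mono abs_le_dyadic_cos_sum)
  also have "\<dots> = 1 + ennreal (2 / (1 - cos 1))
      * (\<Sum>k. (\<integral>\<^sup>+\<omega>. ennreal (2 ^ k * (1 - cos (Y \<omega> / 2 ^ k))) \<partial>M))"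
    by (simp add: nn_integral_add nn_integral_cmult nn_integral_suminf emeasure_space_1)
  also have "\<dots> \<le> 1 + ennreal (2 / (1 - cos 1)) * (\<Sum>k. ennreal (C * q ^ k))"
    by (intro add_left_mono mult_left_mono suminf_le term_le) auto
  also have "(\<Sum>k. ennreal (C * q ^ k)) = ennreal (\<Sum>k. C * q ^ k)"
    using q C by (intro suminf_ennreal2 summable_mult summable_geometric) auto
  also have "1 + ennreal (2 / (1 - cos 1)) * ennreal (\<Sum>k. C * q ^ k) < \<infinity>"
    by (simp add: ennreal_mult_less_top)
  finally show ?thesis by (intro integrableI_bounded) auto
qed

lemma stable_measurable:
  assumes "filtered_prob_space M F" "rot_inv_stable_process M F \<alpha> Z" "0 \<le> t"
  shows "Z t \<in> borel_measurable M"
proof -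
  have "adapted_process F Z"
    using assms(2) unfolding rot_inv_stable_process_def pure_jump_levy_process_def levy_process_def
    by (elim conjE)
  moreover have "subalgebra M (F t)"
    using assms(1) unfolding filtered_prob_space_def by simp
  ultimately show ?thesis
    using \<open>0 \<le> t\<close> measurable_from_subalg[of M "F t" "Z t" borel] by (simp add: adapted_process_def)
qed

lemma stable_char_function:
  assumes "rot_inv_stable_process M F \<alpha> Z" "0 \<le> t"
  shows "(\<integral>\<omega>. cis (u \<bullet> Z t \<omega>) \<partial>M) = exp (of_real t * levy_exponent (stable_levy_measure \<alpha>) u)"
  using assms unfolding rot_inv_stable_process_def pure_jump_levy_process_def by simp

text \<open>
  The two signs of \<open>c\<close> together express both self-similarity and symmetry of the process.
\<close>
lemma stable_self_similar:
  fixes Z :: "real \<Rightarrow> 'w \<Rightarrow> 'a::euclidean_space"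
  assumes "filtered_prob_space M F" and \<alpha>: "0 < \<alpha>" "\<alpha> < 2" and Z: "rot_inv_stable_process M F \<alpha> Z"
    and "0 < t" and c: "\<bar>c\<bar> = t powr (- 1 / \<alpha>)"
  shows "distr M borel (\<lambda>\<omega>. c *\<^sub>R Z t \<omega>) = distr M borel (Z 1)"
proof (rule char_function_uniqueness)
  interpret prob_space M using assms(1) by (simp add: filtered_prob_space_def)
  have [measurable]: "Z t \<in> borel_measurable M" "Z 1 \<in> borel_measurable M"
    using stable_measurable[OF assms(1) Z] \<open>0 < t\<close> by auto
  show "prob_space (distr M borel (\<lambda>\<omega>. c *\<^sub>R Z t \<omega>))" "prob_space (distr M borel (Z 1))"
    by (auto intro: prob_space_distr)
  fix u :: 'a
  have "c \<noteq> 0" using c \<open>0 < t\<close> by auto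
  have "(\<integral>z. cis (u \<bullet> z) \<partial>distr M borel (\<lambda>\<omega>. c *\<^sub>R Z t \<omega>)) = (\<integral>\<omega>. cis (u \<bullet> (c *\<^sub>R Z t \<omega>)) \<partial>M)"
    by (subst integral_distr) (auto simp: cis_conv_exp)
  also have "\<dots> = (\<integral>\<omega>. cis ((c *\<^sub>R u) \<bullet> Z t \<omega>) \<partial>M)"
    by simp
  also have "\<dots> = exp (of_real t * levy_exponent (stable_levy_measure \<alpha>) (c *\<^sub>R u))"
    using \<open>0 < t\<close> by (intro stable_char_function[OF Z]) auto
  also have "of_real t * levy_exponent (stable_levy_measure \<alpha>) (c *\<^sub>R u)
      = of_real (t * \<bar>c\<bar> powr \<alpha>) * levy_exponent (stable_levy_measure \<alpha>) u"
    using stable_exponent_scaleR[OF \<alpha> \<open>c \<noteq> 0\<close>, of u] by simp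
  also have "t * \<bar>c\<bar> powr \<alpha> = 1"
    unfolding c powr_powr using \<open>0 < t\<close> \<alpha> by (simp add: powr_minus)
  also have "exp (of_real 1 * levy_exponent (stable_levy_measure \<alpha>) u) = (\<integral>\<omega>. cis (u \<bullet> Z 1 \<omega>) \<partial>M)"
    using stable_char_function[OF Z, of 1 u] by simp
  also have "\<dots> = (\<integral>z. cis (u \<bullet> z) \<partial>distr M borel (Z 1))"
    by (subst integral_distr) (auto simp: cis_conv_exp)
  finally show "(\<integral>z. cis (u \<bullet> z) \<partial>distr M borel (\<lambda>\<omega>. c *\<^sub>R Z t \<omega>))
      = (\<integral>z. cis (u \<bullet> z) \<partial>distr M borel (Z 1))" .
qed auto

lemma norm_exp_minus_one_le:
  fixes z :: complex
  shows "norm (exp z - 1) \<le> norm z * exp (norm z)"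
proof -
  have "norm (exp z - (\<Sum>k\<le>0. z ^ k / fact k)) \<le> exp \<bar>Re z\<bar> * norm z ^ Suc 0 / fact 0"
    by (rule Taylor_exp)
  also have "\<dots> \<le> exp (norm z) * norm z"
    using abs_Re_le_cmod[of z] by (auto intro: mult_right_mono)
  finally show ?thesis by (simp add: mult.commute)
qed

text \<open>
  The expectation of \<open>1 - cos ((v \<bullet> Z 1) / 2 ^ k)\<close> is the real part of \<open>1 - exp (s * \<psi>)\<close> with \<open>s = (1 / 2 ^ k) powr \<alpha>\<close>,
  hence of order \<open>s\<close>.
\<close>
lemma stable_integrable_inner:
  fixes Z :: "real \<Rightarrow> 'w \<Rightarrow> 'a::euclidean_space"
  assumes "filtered_prob_space M F" and \<alpha>: "1 < \<alpha>" "\<alpha> < 2" and Z: "rot_inv_stable_process M F \<alpha> Z"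
  shows "integrable M (\<lambda>\<omega>. v \<bullet> Z 1 \<omega>)"
proof -
  interpret prob_space M using assms(1) by (simp add: filtered_prob_space_def)
  have [measurable]: "Z 1 \<in> borel_measurable M"
    using stable_measurable[OF assms(1) Z] by auto
  define \<psi> where "\<psi> = levy_exponent (stable_levy_measure \<alpha>) v"
  have "(\<integral>\<omega>. 1 - cos ((v \<bullet> Z 1 \<omega>) / 2 ^ k) \<partial>M) \<le> (norm \<psi> * exp (norm \<psi>)) * (1 / 2 ^ k) powr \<alpha>" for k
  proof -
    define s where "s = (1 / 2 ^ k) powr \<alpha>"
    have s: "0 \<le> s" "s \<le> 1" unfolding s_def using \<alpha> by (auto intro!: powr_le1)
    have int: "integrable M (\<lambda>\<omega>. cis ((v \<bullet> Z 1 \<omega>) / 2 ^ k))"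
      by (intro integrable_cis finite_measure_axioms) auto
    have "(\<integral>\<omega>. cis ((v \<bullet> Z 1 \<omega>) / 2 ^ k) \<partial>M) = (\<integral>\<omega>. cis (((1 / 2 ^ k) *\<^sub>R v) \<bullet> Z 1 \<omega>) \<partial>M)"
      by simp
    also have "\<dots> = exp (of_real s * \<psi>)"
      using stable_char_function[OF Z, of 1 "(1 / 2 ^ k) *\<^sub>R v"]
        stable_exponent_scaleR[of \<alpha> "1 / 2 ^ k" v] \<alpha>
      by (simp add: \<psi>_def s_def)
    finally have char_eq: "(\<integral>\<omega>. cis ((v \<bullet> Z 1 \<omega>) / 2 ^ k) \<partial>M) = exp (of_real s * \<psi>)" .
    have "(\<integral>\<omega>. 1 - cos ((v \<bullet> Z 1 \<omega>) / 2 ^ k) \<partial>M) = Re (1 - exp (of_real s * \<psi>))"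
      using int integral_Re[OF int] integrable_Re[OF int] by (simp add: prob_space char_eq)
    also have "\<dots> \<le> norm (exp (of_real s * \<psi>) - 1)"
      using complex_Re_le_cmod[of "1 - exp (of_real s * \<psi>)"] by (simp add: norm_minus_commute)
    also have "\<dots> \<le> norm (of_real s * \<psi>) * exp (norm (of_real s * \<psi>))"
      by (rule norm_exp_minus_one_le)
    also have "\<dots> \<le> (s * norm \<psi>) * exp (norm \<psi>)"
      using s by (auto simp: norm_mult mult_left_le_one_le intro!: mult_left_mono)
    finally show ?thesis by (simp add: s_def ac_simps)
  qed
  with \<alpha> show ?thesis
    by (intro integrable_if_char_smooth_at_0[OF prob_space_axioms]) auto
qed

lemma stable_mean_zero:
  fixes Z :: "real \<Rightarrow> 'w \<Rightarrow> 'a::euclidean_space"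
  assumes "filtered_prob_space M F" and \<alpha>: "1 < \<alpha>" "\<alpha> < 2" and Z: "rot_inv_stable_process M F \<alpha> Z"
  shows "(\<integral>\<omega>. v \<bullet> Z 1 \<omega> \<partial>M) = 0"
proof -
  have [measurable]: "Z 1 \<in> borel_measurable M"
    by (rule stable_measurable[OF assms(1) Z]) simp
  have "(\<integral>\<omega>. v \<bullet> Z 1 \<omega> \<partial>M) = (\<integral>z. v \<bullet> z \<partial>distr M borel (Z 1))"
    by (subst integral_distr) auto
  also have "\<dots> = (\<integral>z. v \<bullet> z \<partial>distr M borel (\<lambda>\<omega>. (- 1) *\<^sub>R Z 1 \<omega>))"
    using stable_self_similar[OF assms(1) _ _ Z, of 1 "- 1"] \<alpha> by (simp del: scaleR_minus_left)
  also have "\<dots> = - (\<integral>\<omega>. v \<bullet> Z 1 \<omega> \<partial>M)"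
    by (subst integral_distr) auto
  finally show ?thesis by simp
qed


section \<open>Joint measurability of processes and kernels\<close>

definition right_grid :: "nat \<Rightarrow> real \<Rightarrow> real" where
  "right_grid n s = (real (nat \<lfloor>real (Suc n) * max 0 s\<rfloor>) + 1) / real (Suc n)"

lemma right_grid_bounds:
  "max 0 s < right_grid n s" "right_grid n s \<le> max 0 s + inverse (real (Suc n))"
proof -
  define N where "N = real (Suc n)"
  define k where "k = real (nat \<lfloor>N * max 0 s\<rfloor>)"
  have "0 < N" by (simp add: N_def)
  then have "0 \<le> N * max 0 s" by simp
  then have k: "k \<le> N * max 0 s" "N * max 0 s < k + 1"
    unfolding k_def by (auto simp: of_nat_nat)
  have grid: "right_grid n s = (k + 1) / N" by (simp add: right_grid_def N_def k_def)
  show "max 0 s < right_grid n s"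
    using k(2) \<open>0 < N\<close> by (simp add: grid pos_less_divide_eq mult.commute del: max_less_iff_conj)
  have "right_grid n s \<le> (N * max 0 s + 1) / N"
    unfolding grid using k(1) \<open>0 < N\<close> by (intro divide_right_mono) auto
  also have "\<dots> = max 0 s + inverse N"
    using \<open>0 < N\<close> by (simp add: add_divide_distrib inverse_eq_divide)
  finally show "right_grid n s \<le> max 0 s + inverse (real (Suc n))" by (simp add: N_def)
qed

lemma filterlim_right_grid: "filterlim (\<lambda>n. right_grid n s) (at_right (max 0 s)) sequentially"
proof (rule filterlim_at_withinI)
  have lim: "(\<lambda>n. max 0 s + inverse (real (Suc n))) \<longlonglongrightarrow> max 0 s + 0"
    by (intro tendsto_intros LIMSEQ_inverse_real_of_nat)
  show "(\<lambda>n. right_grid n s) \<longlonglongrightarrow> max 0 s"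
  proof (rule tendsto_sandwich)
    show "\<forall>\<^sub>F n in sequentially. max 0 s \<le> right_grid n s"
      using right_grid_bounds(1) by (auto intro!: always_eventually less_imp_le)
    show "\<forall>\<^sub>F n in sequentially. right_grid n s \<le> max 0 s + inverse (real (Suc n))"
      using right_grid_bounds(2) by (intro always_eventually) auto
    show "(\<lambda>n. max 0 s) \<longlonglongrightarrow> max 0 s" by simp
    show "(\<lambda>n. max 0 s + inverse (real (Suc n))) \<longlonglongrightarrow> max 0 s" using lim by simp
  qed
  show "\<forall>\<^sub>F n in sequentially. right_grid n s \<in> {max 0 s<..} - {max 0 s}"
    using right_grid_bounds(1)[of s] by (intro always_eventually) (auto simp: less_imp_neq)
qed

text \<open>
  Replacing the time by the next point of a grid gives a process that depends on time through a
  countable index, hence is jointly measurable; right continuity passes this to the limit. Times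
  are cut off at \<open>0\<close>, since nothing is known about the process at negative times.
\<close>
lemma jointly_measurable_if_right_continuous:
  fixes Y :: "real \<Rightarrow> 'w \<Rightarrow> 'a::metric_space"
  assumes meas: "\<And>s. 0 \<le> s \<Longrightarrow> Y s \<in> borel_measurable M"
    and rc: "\<And>s \<omega>. 0 \<le> s \<Longrightarrow> \<omega> \<in> space M \<Longrightarrow> ((\<lambda>r. Y r \<omega>) \<longlongrightarrow> Y s \<omega>) (at_right s)"
  shows "(\<lambda>(s, \<omega>). Y (max 0 s) \<omega>) \<in> borel_measurable (borel \<Otimes>\<^sub>M M)"
proof (rule borel_measurable_LIMSEQ_metric)
  fix n
  have [measurable]: "(\<lambda>p. Y ((real i + 1) / real (Suc n)) (snd p)) \<in> borel_measurable (borel \<Otimes>\<^sub>M M)" for i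
    by (intro measurable_compose[OF measurable_snd] meas) simp
  have "(\<lambda>p. Y ((real (nat \<lfloor>real (Suc n) * max 0 (fst p)\<rfloor>) + 1) / real (Suc n)) (snd p))
      \<in> borel_measurable (borel \<Otimes>\<^sub>M M)"
    by (rule measurable_compose_countable
        [where f = "\<lambda>i p. Y ((real i + 1) / real (Suc n)) (snd p)"]) measurable
  then show "(\<lambda>(s :: real, \<omega>). Y (right_grid n s) \<omega>) \<in> borel_measurable (borel \<Otimes>\<^sub>M M)"
    unfolding right_grid_def by (simp add: case_prod_beta')
next
  fix p :: "real \<times> 'w" assume "p \<in> space (borel \<Otimes>\<^sub>M M)"
  then obtain s \<omega> where p: "p = (s, \<omega>)" "\<omega> \<in> space M" by (auto simp: space_pair_measure)
  have "(\<lambda>n. Y (right_grid n s) \<omega>) \<longlonglongrightarrow> Y (max 0 s) \<omega>"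
    using p(2) by (intro filterlim_compose[OF rc filterlim_right_grid]) auto
  then show "(\<lambda>n. case p of (s, \<omega>) \<Rightarrow> Y (right_grid n s) \<omega>) \<longlonglongrightarrow> (case p of (s, \<omega>) \<Rightarrow> Y (max 0 s) \<omega>)"
    using p by simp
qed

lemma tendsto_integral_closed_approx:
  fixes C :: "'a::metric_space set"
  assumes "prob_space \<mu>" and [measurable_cong]: "sets \<mu> = sets borel" and C: "closed C" "C \<noteq> {}"
  shows "(\<lambda>k. \<integral>y. max 0 (1 - real k * infdist y C) \<partial>\<mu>) \<longlonglongrightarrow> measure \<mu> C"
proof -
  interpret prob_space \<mu> by fact
  have [measurable]: "C \<in> sets borel" using C by simp
  have [measurable]: "(\<lambda>y. infdist y C) \<in> borel_measurable borel"
    by (intro borel_measurable_continuous_onI continuous_intros)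
  have "(\<lambda>k. \<integral>y. max 0 (1 - real k * infdist y C) \<partial>\<mu>) \<longlonglongrightarrow> (\<integral>y. indicat_real C y \<partial>\<mu>)"
  proof (rule integral_dominated_convergence)
    show "integrable \<mu> (\<lambda>_. 1 :: real)" by simp
    show "AE y in \<mu>. norm (max 0 (1 - real k * infdist y C)) \<le> 1" for k
      by (auto simp: infdist_nonneg)
    show "AE y in \<mu>. (\<lambda>k. max 0 (1 - real k * infdist y C)) \<longlonglongrightarrow> indicat_real C y"
    proof (rule AE_I2)
      fix y
      show "(\<lambda>k. max 0 (1 - real k * infdist y C)) \<longlonglongrightarrow> indicat_real C y"
      proof (cases "y \<in> C")
        case True
        then show ?thesis by simp
      next
        case False
        then have pos: "0 < infdist y C"
          using C in_closed_iff_infdist_zero[of C y] infdist_nonneg[of y C] by auto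
        obtain N where N: "1 / infdist y C < real N" using reals_Archimedean2 by blast
        have "max 0 (1 - real k * infdist y C) = 0" if "N \<le> k" for k
        proof -
          have "1 / infdist y C \<le> real k" using N that by simp
          then show ?thesis using pos by (simp add: field_simps)
        qed
        then have "\<forall>\<^sub>F k in sequentially. max 0 (1 - real k * infdist y C) = 0"
          by (auto simp: eventually_sequentially)
        then show ?thesis using False by (simp add: tendsto_eventually)
      qed
    qed
  qed measurable
  then show ?thesis by simp
qed

text \<open>
  Closed sets generate the Borel sets and their indicators are limits of continuous functions, so
  it suffices that integrals of bounded continuous functions against the kernel are right
  continuous in time.
\<close>
lemma kernel_jointly_measurable:
  fixes P :: "real \<Rightarrow> 'a::metric_space \<Rightarrow> 'b::metric_space measure"
  assumes P: "\<And>t. 0 \<le> t \<Longrightarrow> P t \<in> borel \<rightarrow>\<^sub>M prob_algebra borel"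
    and rc: "\<And>t x f. 0 \<le> t \<Longrightarrow> continuous_on UNIV f \<Longrightarrow> (\<And>y. \<bar>f y\<bar> \<le> 1) \<Longrightarrow>
      ((\<lambda>r. \<integral>y. f y \<partial>P r x :: real) \<longlongrightarrow> (\<integral>y. f y \<partial>P t x)) (at_right t)"
  shows "(\<lambda>(t, x). P (max 0 t) x) \<in> borel \<Otimes>\<^sub>M borel \<rightarrow>\<^sub>M prob_algebra borel"
proof (rule measurable_prob_algebra_generated[where \<Omega> = UNIV and G = "Collect closed"])
  show "sets borel = sigma_sets (UNIV::'b set) (Collect closed)"
    by (simp add: borel_eq_closed)
  show "Int_stable (Collect closed :: 'b set set)" by (auto simp: Int_stable_def)
  have "P (max 0 t) x \<in> space (prob_algebra borel)" for t x
    using measurable_space[OF P, of "max 0 t" x] by simp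
  then have P_space: "prob_space (P (max 0 t) x)" "sets (P (max 0 t) x) = sets borel" for t x
    by (auto simp: space_prob_algebra)
  then show "prob_space (case a of (t, x) \<Rightarrow> P (max 0 t) x)" "sets (case a of (t, x) \<Rightarrow> P (max 0 t) x) = sets borel"
    for a by (auto split: prod.split)
  fix C :: "'b set" assume "C \<in> Collect closed"
  then have C: "closed C" by simp
  show "(\<lambda>a. emeasure (case a of (t, x) \<Rightarrow> P (max 0 t) x) C) \<in> borel_measurable (borel \<Otimes>\<^sub>M borel)"
  proof (cases "C = {}")
    case False
    have "(\<lambda>(t, x). measure (P (max 0 t) x) C) \<in> borel_measurable (borel \<Otimes>\<^sub>M borel)"
    proof (rule borel_measurable_LIMSEQ_metric)
      fix k :: nat
      let ?f = "\<lambda>y. max 0 (1 - real k * infdist y C)"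
      have cont: "continuous_on UNIV ?f" by (intro continuous_intros)
      then have [measurable]: "?f \<in> borel_measurable borel" by (rule borel_measurable_continuous_onI)
      show "(\<lambda>(t, x). \<integral>y. ?f y \<partial>P (max 0 t) x) \<in> borel_measurable (borel \<Otimes>\<^sub>M borel)"
      proof (rule jointly_measurable_if_right_continuous)
        show "(\<lambda>x. \<integral>y. ?f y \<partial>P s x) \<in> borel_measurable borel" if "0 \<le> s" for s
          by (rule measurable_compose[OF measurable_prob_algebraD[OF P[OF that]]
                integral_measurable_subprob_algebra]) measurable
        show "((\<lambda>r. \<integral>y. ?f y \<partial>P r x) \<longlongrightarrow> (\<integral>y. ?f y \<partial>P s x)) (at_right s)" if "0 \<le> s" for s x
          by (rule rc[OF that cont]) (auto simp: infdist_nonneg)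
      qed
    next
      fix p :: "real \<times> 'a"
      show "(\<lambda>k. case p of (t, x) \<Rightarrow> \<integral>y. max 0 (1 - real k * infdist y C) \<partial>P (max 0 t) x)
          \<longlonglongrightarrow> (case p of (t, x) \<Rightarrow> measure (P (max 0 t) x) C)"
        using tendsto_integral_closed_approx[OF P_space C False] by (auto split: prod.split)
    qed
    then have "(\<lambda>p. ennreal (case p of (t, x) \<Rightarrow> measure (P (max 0 t) x) C)) \<in> borel_measurable (borel \<Otimes>\<^sub>M borel)"
      by measurable
    moreover have "ennreal (case p of (t, x) \<Rightarrow> measure (P (max 0 t) x) C)
        = emeasure (case p of (t, x) \<Rightarrow> P (max 0 t) x) C" for p
      using P_space(1) by (auto split: prod.split simp: finite_measure.emeasure_eq_measure prob_space_def)
    ultimately show ?thesis by simp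
  qed simp
qed simp_all


section \<open>Invariant measures and time averages\<close>

text \<open>
  For nonnegative functions this is the definition of the mixture \<open>\<pi> \<bind> K\<close>; an integrable function is
  split into its positive and negative parts.
\<close>
lemma invariant_kernel_integral:
  fixes f :: "'a \<Rightarrow> real"
  assumes K: "K \<in> N \<rightarrow>\<^sub>M prob_algebra N" and \<pi>[measurable_cong]: "sets \<pi> = sets N"
    and inv: "\<pi> \<bind> K = \<pi>" and f: "integrable \<pi> f"
  shows "AE x in \<pi>. integrable (K x) f"
    and "integrable \<pi> (\<lambda>x. \<integral>y. f y \<partial>K x)"
    and "(\<integral>x. (\<integral>y. f y \<partial>K x) \<partial>\<pi>) = (\<integral>y. f y \<partial>\<pi>)"
proof -
  have [measurable]: "f \<in> borel_measurable N"
    using borel_measurable_integrable[OF f] by simp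
  have K_sub [measurable]: "K \<in> N \<rightarrow>\<^sub>M subprob_algebra N" by (rule measurable_prob_algebraD[OF K])
  have K_sub' : "K \<in> \<pi> \<rightarrow>\<^sub>M subprob_algebra N" by measurable
  have sets_K: "sets (K x) = sets N" if "x \<in> space \<pi>" for x
    using that by (intro subprob_measurableD(2)[OF K_sub'])
  have nn: "(\<integral>\<^sup>+x. (\<integral>\<^sup>+y. h y \<partial>K x) \<partial>\<pi>) = (\<integral>\<^sup>+y. h y \<partial>\<pi>)"
    if [measurable]: "h \<in> borel_measurable N" for h
    using nn_integral_bind[OF that K_sub'] by (simp add: inv)
  have nonneg: "(AE x in \<pi>. integrable (K x) h) \<and> integrable \<pi> (\<lambda>x. \<integral>y. h y \<partial>K x)
      \<and> (\<integral>x. (\<integral>y. h y \<partial>K x) \<partial>\<pi>) = (\<integral>y. h y \<partial>\<pi>)"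
    if h: "integrable \<pi> h" and pos: "\<And>y. 0 \<le> h y" and [measurable]: "h \<in> borel_measurable N" for h :: "'a \<Rightarrow> real"
  proof -
    have fin: "(\<integral>\<^sup>+x. (\<integral>\<^sup>+y. h y \<partial>K x) \<partial>\<pi>) < \<infinity>"
      using nn[of h] nn_integral_eq_integral[OF h] pos by simp
    have [measurable]: "(\<lambda>x. \<integral>\<^sup>+y. h y \<partial>K x) \<in> borel_measurable \<pi>"
      by (rule measurable_compose[OF K_sub' nn_integral_measurable_subprob_algebra]) measurable
    have [measurable]: "(\<lambda>x. \<integral>y. h y \<partial>K x) \<in> borel_measurable \<pi>"
      by (rule measurable_compose[OF K_sub' integral_measurable_subprob_algebra]) measurable
    have "AE x in \<pi>. (\<integral>\<^sup>+y. h y \<partial>K x) \<noteq> \<infinity>"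
      using fin by (intro nn_integral_PInf_AE) auto
    then have int: "AE x in \<pi>. integrable (K x) h"
    proof (rule AE_mp, intro AE_I2 impI)
      fix x assume x: "x \<in> space \<pi>" and "(\<integral>\<^sup>+y. h y \<partial>K x) \<noteq> \<infinity>"
      then show "integrable (K x) h"
        using pos by (intro integrableI_bounded) (auto simp: less_top measurable_cong_sets[OF sets_K[OF x] refl])
    qed
    then have eq: "(\<integral>\<^sup>+x. ennreal (\<integral>y. h y \<partial>K x) \<partial>\<pi>) = (\<integral>\<^sup>+y. h y \<partial>\<pi>)"
      unfolding nn[of h, symmetric, simplified]
      using pos by (intro nn_integral_cong_AE) (auto simp: nn_integral_eq_integral elim!: AE_mp)
    have pos': "0 \<le> (\<integral>y. h y \<partial>K x)" for x
      using pos by (intro Bochner_Integration.integral_nonneg)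
    have "integrable \<pi> (\<lambda>x. \<integral>y. h y \<partial>K x)"
      using pos' fin eq nn[of h] by (intro integrableI_bounded) auto
    moreover have "(\<integral>x. (\<integral>y. h y \<partial>K x) \<partial>\<pi>) = (\<integral>y. h y \<partial>\<pi>)"
      using pos pos' by (simp add: integral_eq_nn_integral eq)
    ultimately show ?thesis using int by simp
  qed
  define p where "p y = max 0 (f y)" for y
  define q where "q y = max 0 (- f y)" for y
  have [measurable]: "p \<in> borel_measurable N" "q \<in> borel_measurable N"
    unfolding p_def q_def by measurable
  have f_eq: "f = (\<lambda>y. p y - q y)" by (auto simp: p_def q_def)
  have "integrable \<pi> p" "integrable \<pi> q"
    unfolding p_def q_def using f by auto
  then have p: "(AE x in \<pi>. integrable (K x) p)" "integrable \<pi> (\<lambda>x. \<integral>y. p y \<partial>K x)"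
      "(\<integral>x. (\<integral>y. p y \<partial>K x) \<partial>\<pi>) = (\<integral>y. p y \<partial>\<pi>)"
    and q: "(AE x in \<pi>. integrable (K x) q)" "integrable \<pi> (\<lambda>x. \<integral>y. q y \<partial>K x)"
      "(\<integral>x. (\<integral>y. q y \<partial>K x) \<partial>\<pi>) = (\<integral>y. q y \<partial>\<pi>)"
    and pq: "integrable \<pi> p" "integrable \<pi> q"
    using nonneg[of p] nonneg[of q] by (auto simp: p_def q_def)
  have [measurable]: "(\<lambda>x. \<integral>y. f y \<partial>K x) \<in> borel_measurable \<pi>"
    by (rule measurable_compose[OF K_sub' integral_measurable_subprob_algebra]) measurable
  show "AE x in \<pi>. integrable (K x) f"
    using p(1) q(1) unfolding f_eq by eventually_elim simp
  have AE_eq: "AE x in \<pi>. (\<integral>y. f y \<partial>K x) = (\<integral>y. p y \<partial>K x) - (\<integral>y. q y \<partial>K x)"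
    using p(1) q(1) unfolding f_eq by eventually_elim simp
  have int_diff: "integrable \<pi> (\<lambda>x. (\<integral>y. p y \<partial>K x) - (\<integral>y. q y \<partial>K x))"
    using p(2) q(2) by simp
  show "integrable \<pi> (\<lambda>x. \<integral>y. f y \<partial>K x)"
    using AE_eq int_diff by (subst integrable_cong_AE[OF _ _ AE_eq]) auto
  have "(\<integral>x. (\<integral>y. f y \<partial>K x) \<partial>\<pi>) = (\<integral>x. (\<integral>y. p y \<partial>K x) - (\<integral>y. q y \<partial>K x) \<partial>\<pi>)"
    using AE_eq int_diff by (intro integral_cong_AE) auto
  also have "\<dots> = (\<integral>y. f y \<partial>\<pi>)"
    using p(2,3) q(2,3) pq unfolding f_eq by simp
  finally show "(\<integral>x. (\<integral>y. f y \<partial>K x) \<partial>\<pi>) = (\<integral>y. f y \<partial>\<pi>)" .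
qed

lemma invariant_bind_mixture:
  assumes U: "prob_space U" and \<pi>: "prob_space \<pi>" and [measurable_cong]: "sets \<pi> = sets N"
    and K: "(\<lambda>(s, x). K s x) \<in> U \<Otimes>\<^sub>M N \<rightarrow>\<^sub>M prob_algebra N"
    and inv: "\<And>s. s \<in> space U \<Longrightarrow> \<pi> \<bind> K s = \<pi>"
  shows "(\<lambda>x. U \<bind> (\<lambda>s. K s x)) \<in> N \<rightarrow>\<^sub>M prob_algebra N"
    and "\<pi> \<bind> (\<lambda>x. U \<bind> (\<lambda>s. K s x)) = \<pi>"
proof -
  interpret U: prob_space U by fact
  interpret \<pi>: prob_space \<pi> by fact
  interpret pair_sigma_finite \<pi> U ..
  have U_space: "U \<in> space (prob_algebra U)"
    using U by (simp add: space_prob_algebra)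
  have swap: "(\<lambda>(x, s). K s x) \<in> N \<Otimes>\<^sub>M U \<rightarrow>\<^sub>M prob_algebra N"
    using measurable_compose[OF measurable_pair_swap' K] by (simp add: split_beta')
  show avg: "(\<lambda>x. U \<bind> (\<lambda>s. K s x)) \<in> N \<rightarrow>\<^sub>M prob_algebra N"
    by (rule measurable_bind_prob_space2[OF measurable_const[OF U_space] swap])
  then have avg': "(\<lambda>x. U \<bind> (\<lambda>s. K s x)) \<in> \<pi> \<rightarrow>\<^sub>M subprob_algebra N"
    by (intro measurable_prob_algebraD) (simp cong: measurable_cong_sets)
  have K_s: "(\<lambda>s. K s x) \<in> U \<rightarrow>\<^sub>M subprob_algebra N" if "x \<in> space N" for x
    using measurable_compose[OF measurable_Pair2'[OF that, of U] measurable_prob_algebraD[OF K]] by simp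
  have K_x: "K s \<in> \<pi> \<rightarrow>\<^sub>M subprob_algebra N" if "s \<in> space U" for s
    using measurable_compose[OF measurable_Pair1'[OF that, of N] measurable_prob_algebraD[OF K]]
    by (simp cong: measurable_cong_sets)
  have space_\<pi>: "space \<pi> = space N" by (rule sets_eq_imp_space_eq) fact
  show "\<pi> \<bind> (\<lambda>x. U \<bind> (\<lambda>s. K s x)) = \<pi>"
  proof (rule measure_eqI)
    show sets_eq: "sets (\<pi> \<bind> (\<lambda>x. U \<bind> (\<lambda>s. K s x))) = sets \<pi>"
      using sets_bind[OF subprob_measurableD(2)[OF avg'] \<pi>.not_empty] \<open>sets \<pi> = sets N\<close> by simp
    fix A assume "A \<in> sets (\<pi> \<bind> (\<lambda>x. U \<bind> (\<lambda>s. K s x)))"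
    then have A [measurable]: "A \<in> sets N" using sets_eq \<open>sets \<pi> = sets N\<close> by simp
    have meas: "(\<lambda>(x, s). emeasure (K s x) A) \<in> borel_measurable (\<pi> \<Otimes>\<^sub>M U)"
      using measurable_compose[OF measurable_prob_algebraD[OF swap] measurable_emeasure_subprob_algebra[OF A]]
      by (simp add: split_beta' cong: measurable_cong_sets)
    have "emeasure (\<pi> \<bind> (\<lambda>x. U \<bind> (\<lambda>s. K s x))) A = (\<integral>\<^sup>+x. emeasure (U \<bind> (\<lambda>s. K s x)) A \<partial>\<pi>)"
      by (rule emeasure_bind[OF \<pi>.not_empty avg' A])
    also have "\<dots> = (\<integral>\<^sup>+x. (\<integral>\<^sup>+s. emeasure (K s x) A \<partial>U) \<partial>\<pi>)"
      by (intro nn_integral_cong emeasure_bind[OF U.not_empty K_s A]) (simp add: space_\<pi>)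
    also have "\<dots> = (\<integral>\<^sup>+s. (\<integral>\<^sup>+x. emeasure (K s x) A \<partial>\<pi>) \<partial>U)"
      using Fubini'[OF meas] by simp
    also have "\<dots> = (\<integral>\<^sup>+s. emeasure (\<pi> \<bind> K s) A \<partial>U)"
      by (intro nn_integral_cong emeasure_bind[symmetric, OF \<pi>.not_empty K_x A])
    also have "\<dots> = (\<integral>\<^sup>+s. emeasure \<pi> A \<partial>U)"
      using inv by (intro nn_integral_cong) simp
    also have "\<dots> = emeasure \<pi> A"
      by (simp add: U.emeasure_space_1)
    finally show "emeasure (\<pi> \<bind> (\<lambda>x. U \<bind> (\<lambda>s. K s x))) A = emeasure \<pi> A" .
  qed
qed

text \<open>
  Sampling the time first and then the process at that time is the same as evaluating the process
  at an independent random time.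
\<close>
lemma bind_distr_eq_distr_pair:
  assumes U: "prob_space U" and M: "prob_space M"
    and Y [measurable]: "(\<lambda>(s, \<omega>). Y s \<omega>) \<in> U \<Otimes>\<^sub>M M \<rightarrow>\<^sub>M N"
    and K: "(\<lambda>s. distr M N (Y s)) \<in> U \<rightarrow>\<^sub>M subprob_algebra N"
  shows "U \<bind> (\<lambda>s. distr M N (Y s)) = distr (U \<Otimes>\<^sub>M M) N (\<lambda>(s, \<omega>). Y s \<omega>)"
proof (rule measure_eqI)
  interpret U: prob_space U by fact
  interpret M: prob_space M by fact
  show sets_eq: "sets (U \<bind> (\<lambda>s. distr M N (Y s))) = sets (distr (U \<Otimes>\<^sub>M M) N (\<lambda>(s, \<omega>). Y s \<omega>))"
    using sets_bind[OF _ U.not_empty, of "\<lambda>s. distr M N (Y s)" N] by simp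
  fix A assume "A \<in> sets (U \<bind> (\<lambda>s. distr M N (Y s)))"
  then have A [measurable]: "A \<in> sets N" using sets_eq by simp
  have Y_s: "Y s \<in> M \<rightarrow>\<^sub>M N" if "s \<in> space U" for s
    using measurable_compose[OF measurable_Pair1'[OF that, of M] Y] by simp
  have "emeasure (U \<bind> (\<lambda>s. distr M N (Y s))) A = (\<integral>\<^sup>+s. emeasure (distr M N (Y s)) A \<partial>U)"
    by (rule emeasure_bind[OF U.not_empty K A])
  also have "\<dots> = (\<integral>\<^sup>+s. (\<integral>\<^sup>+\<omega>. indicator A (Y s \<omega>) \<partial>M) \<partial>U)"
  proof (rule nn_integral_cong)
    fix s assume s: "s \<in> space U"
    have "emeasure (distr M N (Y s)) A = (\<integral>\<^sup>+y. indicator A y \<partial>distr M N (Y s))" by simp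
    also have "\<dots> = (\<integral>\<^sup>+\<omega>. indicator A (Y s \<omega>) \<partial>M)"
      by (rule nn_integral_distr[OF Y_s[OF s]]) simp
    finally show "emeasure (distr M N (Y s)) A = (\<integral>\<^sup>+\<omega>. indicator A (Y s \<omega>) \<partial>M)" .
  qed
  also have "\<dots> = (\<integral>\<^sup>+p. indicator A (Y (fst p) (snd p)) \<partial>(U \<Otimes>\<^sub>M M))"
    by (subst M.nn_integral_fst[symmetric]) (simp_all, measurable)
  also have "\<dots> = (\<integral>\<^sup>+y. indicator A y \<partial>distr (U \<Otimes>\<^sub>M M) N (\<lambda>(s, \<omega>). Y s \<omega>))"
    by (subst nn_integral_distr[OF Y]) (simp_all add: split_beta')
  finally show "emeasure (U \<bind> (\<lambda>s. distr M N (Y s))) A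
      = emeasure (distr (U \<Otimes>\<^sub>M M) N (\<lambda>(s, \<omega>). Y s \<omega>)) A" by simp
qed


section \<open>The stationary mean of the drift vanishes\<close>

definition truncate :: "nat \<Rightarrow> real \<Rightarrow> real" where
  "truncate n y = max (- real n) (min (real n) y)"

lemma truncate_measurable [measurable]: "truncate n \<in> borel_measurable borel"
  unfolding truncate_def by measurable

lemma abs_truncate_le: "\<bar>truncate n y\<bar> \<le> real n"
  by (auto simp: truncate_def)

lemma abs_truncate_diff_le: "\<bar>truncate n a - truncate n b\<bar> \<le> \<bar>a - b\<bar>"
  by (auto simp: truncate_def)

lemma truncate_tendsto: "(\<lambda>n. truncate n y) \<longlonglongrightarrow> y"
proof -
  obtain N where N: "\<bar>y\<bar> < real N" using reals_Archimedean2 by blast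
  have "truncate n y = y" if "N \<le> n" for n
  proof -
    have "\<bar>y\<bar> < real n" using N that by simp
    then show ?thesis by (auto simp: truncate_def)
  qed
  then show ?thesis
    by (intro tendsto_eventually) (auto simp: eventually_sequentially)
qed

text \<open>
  For a stationary pair, \<open>v \<bullet> X\<^sub>1 - v \<bullet> X\<^sub>0\<close> may be integrable although \<open>v \<bullet> X\<^sub>0\<close> is not. Truncation gives bounded
  functions, whose increments have mean zero by stationarity; it is a contraction, so the increments
  stay dominated as the truncation level grows.
\<close>
lemma truncated_increment:
  fixes Y :: "'w \<Rightarrow> real"
  assumes "prob_space M" and [measurable]: "Y \<in> borel_measurable M"
    and int: "integrable M (\<lambda>\<omega>. Y \<omega> - a)"
  shows "(\<lambda>n. (\<integral>\<omega>. truncate n (Y \<omega>) \<partial>M) - truncate n a) \<longlonglongrightarrow> (\<integral>\<omega>. Y \<omega> - a \<partial>M)"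
    and "\<bar>(\<integral>\<omega>. truncate n (Y \<omega>) \<partial>M) - truncate n a\<bar> \<le> (\<integral>\<omega>. \<bar>Y \<omega> - a\<bar> \<partial>M)"
proof -
  interpret prob_space M by fact
  have trunc: "integrable M (\<lambda>\<omega>. truncate n (Y \<omega>))" for n
    by (intro integrable_const_bound[of _ "real n"]) (auto simp: abs_truncate_le)
  have eq: "(\<integral>\<omega>. truncate n (Y \<omega>) \<partial>M) - truncate n a = (\<integral>\<omega>. truncate n (Y \<omega>) - truncate n a \<partial>M)" for n
    using trunc by (simp add: prob_space)
  show "(\<lambda>n. (\<integral>\<omega>. truncate n (Y \<omega>) \<partial>M) - truncate n a) \<longlonglongrightarrow> (\<integral>\<omega>. Y \<omega> - a \<partial>M)"
    unfolding eq
  proof (rule integral_dominated_convergence)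
    show "integrable M (\<lambda>\<omega>. \<bar>Y \<omega> - a\<bar>)" using int by simp
    show "AE \<omega> in M. (\<lambda>n. truncate n (Y \<omega>) - truncate n a) \<longlonglongrightarrow> Y \<omega> - a"
      by (intro AE_I2 tendsto_diff truncate_tendsto)
    show "AE \<omega> in M. norm (truncate n (Y \<omega>) - truncate n a) \<le> \<bar>Y \<omega> - a\<bar>" for n
      by (simp add: abs_truncate_diff_le)
  qed auto
  have "\<bar>\<integral>\<omega>. truncate n (Y \<omega>) - truncate n a \<partial>M\<bar> \<le> (\<integral>\<omega>. \<bar>truncate n (Y \<omega>) - truncate n a\<bar> \<partial>M)"
    by (rule integral_abs_bound)
  also have "\<dots> \<le> (\<integral>\<omega>. \<bar>Y \<omega> - a\<bar> \<partial>M)"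
    using trunc int by (intro integral_mono) (auto simp: abs_truncate_diff_le)
  finally show "\<bar>(\<integral>\<omega>. truncate n (Y \<omega>) \<partial>M) - truncate n a\<bar> \<le> (\<integral>\<omega>. \<bar>Y \<omega> - a\<bar> \<partial>M)"
    unfolding eq .
qed

lemma transition_law_right_continuous:
  fixes X :: "'a::euclidean_space \<Rightarrow> real \<Rightarrow> 'w \<Rightarrow> 'a"
  assumes "prob_space M" and meas: "\<And>s. 0 \<le> s \<Longrightarrow> X x s \<in> borel_measurable M"
    and cadlag: "\<And>\<omega>. \<omega> \<in> space M \<Longrightarrow> cadlag (\<lambda>s. X x s \<omega>)"
    and "0 \<le> t" and f: "continuous_on UNIV f" "\<And>y. \<bar>f y\<bar> \<le> 1"
  shows "((\<lambda>r. \<integral>y. f y \<partial>transition_law M X r x :: real) \<longlongrightarrow> (\<integral>y. f y \<partial>transition_law M X t x)) (at_right t)"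
proof -
  interpret prob_space M by fact
  have [measurable]: "f \<in> borel_measurable borel" by (rule borel_measurable_continuous_onI[OF f(1)])
  have law: "(\<integral>y. f y \<partial>transition_law M X r x) = (\<integral>\<omega>. f (X x r \<omega>) \<partial>M)" if "0 \<le> r" for r
    unfolding transition_law_def using meas[OF that] by (intro integral_distr) auto
  have "(\<lambda>n. \<integral>y. f y \<partial>transition_law M X (r n) x) \<longlonglongrightarrow> (\<integral>y. f y \<partial>transition_law M X t x)"
    if r: "\<And>n. r n \<in> {t<..}" and lim: "r \<longlonglongrightarrow> t" for r :: "nat \<Rightarrow> real"
  proof -
    have r_nonneg: "0 \<le> r n" for n using r[of n] \<open>0 \<le> t\<close> by simp
    have filter: "filterlim r (at_right t) sequentially"
      using r lim by (intro filterlim_at_withinI) (auto simp: less_imp_neq)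
    have "(\<lambda>n. \<integral>\<omega>. f (X x (r n) \<omega>) \<partial>M) \<longlonglongrightarrow> (\<integral>\<omega>. f (X x t \<omega>) \<partial>M)"
    proof (rule integral_dominated_convergence)
      show "(\<lambda>\<omega>. f (X x t \<omega>)) \<in> borel_measurable M" using meas[OF \<open>0 \<le> t\<close>] by simp
      show "(\<lambda>\<omega>. f (X x (r n) \<omega>)) \<in> borel_measurable M" for n using meas[OF r_nonneg] by simp
      show "integrable M (\<lambda>_. 1 :: real)" by simp
      show "AE \<omega> in M. norm (f (X x (r n) \<omega>)) \<le> 1" for n using f(2) by simp
      show "AE \<omega> in M. (\<lambda>n. f (X x (r n) \<omega>)) \<longlonglongrightarrow> f (X x t \<omega>)"
      proof (rule AE_I2)
        fix \<omega> assume "\<omega> \<in> space M"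
        then have "((\<lambda>s. X x s \<omega>) \<longlongrightarrow> X x t \<omega>) (at_right t)"
          using cadlag \<open>0 \<le> t\<close> unfolding cadlag_def by simp
        from filterlim_compose[OF this filter]
        have "(\<lambda>n. X x (r n) \<omega>) \<longlonglongrightarrow> X x t \<omega>" .
        with f(1) show "(\<lambda>n. f (X x (r n) \<omega>)) \<longlonglongrightarrow> f (X x t \<omega>)"
          by (auto intro: continuous_on_tendsto_compose)
      qed
    qed
    then show ?thesis by (simp add: law r_nonneg \<open>0 \<le> t\<close>)
  qed
  then show ?thesis
    unfolding tendsto_at_iff_sequentially comp_def by auto
qed

text \<open>
  By the equation, the displacement \<open>v \<bullet> X\<^sub>1 - v \<bullet> x\<close> is a time integral of \<open>v \<bullet> g\<close> along the path plus the
  centred variable \<open>v \<bullet> Z\<^sub>1\<close>. Its mean, as a function of the starting point \<open>x\<close>, is the integral of \<open>v \<bullet> g\<close>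
  against the law of the process at a uniform random time in \<open>[0, 1]\<close>. This averaged kernel leaves
  \<open>\<pi>\<close> invariant, so averaging over \<open>\<pi>\<close> gives \<open>\<pi>(v \<bullet> g)\<close>. On the other hand the average displacement of a
  stationary process is zero, by truncation and dominated convergence.
\<close>
lemma stationary_drift_inner_zero:
  fixes M :: "'w measure"
    and F :: "real \<Rightarrow> 'w measure"
    and Z :: "real \<Rightarrow> 'w \<Rightarrow> 'a::euclidean_space"
    and X :: "'a \<Rightarrow> real \<Rightarrow> 'w \<Rightarrow> 'a"
    and g :: "'a \<Rightarrow> 'a"
  assumes "prob_space M"
    and Z_meas: "Z 1 \<in> borel_measurable M"
    and Z_int: "integrable M (\<lambda>\<omega>. v \<bullet> Z 1 \<omega>)" and Z_mean: "(\<integral>\<omega>. v \<bullet> Z 1 \<omega> \<partial>M) = 0"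
    and sol: "\<And>x. sde_solution M F Z g x (X x)"
    and markov: "markov_process M X"
    and inv: "invariant_prob (transition_law M X) \<pi>"
    and g: "integrable \<pi> g"
  shows "(\<integral>y. v \<bullet> g y \<partial>\<pi>) = 0"
proof -
  interpret prob_space M by fact
  define P where "P = transition_law M X"
  have "prob_space \<pi>" and sets_\<pi> [measurable_cong]: "sets \<pi> = sets borel"
    and inv_P: "0 \<le> t \<Longrightarrow> \<pi> \<bind> P t = \<pi>" for t
    using inv unfolding invariant_prob_def P_def by (auto simp: space_prob_algebra)
  interpret \<pi>: prob_space \<pi> by fact
  have [measurable]: "Z 1 \<in> borel_measurable M" by fact
  have X_meas: "X x t \<in> borel_measurable M" if "0 \<le> t" for x t
    using markov that unfolding markov_process_def by simp
  have P_kernel: "P t \<in> borel \<rightarrow>\<^sub>M prob_algebra borel" if "0 \<le> t" for t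
    using markov that unfolding markov_process_def P_def by simp
  have X_cadlag: "cadlag (\<lambda>t. X x t \<omega>)" if "\<omega> \<in> space M" for x \<omega>
    using sol that unfolding sde_solution_def by simp
  have X_joint [measurable]: "(\<lambda>(s, \<omega>). X x (max 0 s) \<omega>) \<in> borel_measurable (borel \<Otimes>\<^sub>M M)" for x
  proof (rule jointly_measurable_if_right_continuous)
    show "X x s \<in> borel_measurable M" if "0 \<le> s" for s by (rule X_meas[OF that])
    show "((\<lambda>r. X x r \<omega>) \<longlongrightarrow> X x s \<omega>) (at_right s)" if "0 \<le> s" "\<omega> \<in> space M" for s \<omega>
      using X_cadlag[OF that(2), of x] that(1) unfolding cadlag_def by simp
  qed
  have P_joint: "(\<lambda>(s, x). P (max 0 s) x) \<in> borel \<Otimes>\<^sub>M borel \<rightarrow>\<^sub>M prob_algebra borel"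
    by (rule kernel_jointly_measurable[OF P_kernel])
       (simp_all only: P_def transition_law_right_continuous[OF \<open>prob_space M\<close> X_meas X_cadlag])
  have g_meas [measurable]: "g \<in> borel_measurable borel"
    using borel_measurable_integrable[OF g] by simp

  \<comment> \<open>The uniform law on \<open>[0, 1]\<close>; \<open>R x\<close> is then the law of \<open>X x\<close> at a uniform random time.\<close>
  define U where "U = density lborel (\<lambda>s::real. ennreal (indicat_real {0..1} s))"
  have sets_U [measurable_cong]: "sets U = sets borel" by (simp add: U_def)
  have "prob_space U"
    by (rule prob_spaceI) (simp add: U_def ennreal_indicator emeasure_restricted)
  interpret U: prob_space U by fact
  interpret UM: pair_prob_space U M ..
  define R where "R x = U \<bind> (\<lambda>s. P (max 0 s) x)" for x
  have P_joint': "(\<lambda>(s, x). P (max 0 s) x) \<in> U \<Otimes>\<^sub>M borel \<rightarrow>\<^sub>M prob_algebra borel"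
    using P_joint by (simp cong: measurable_cong_sets)
  have R_kernel: "R \<in> borel \<rightarrow>\<^sub>M prob_algebra borel" and R_inv: "\<pi> \<bind> R = \<pi>"
    using invariant_bind_mixture[OF \<open>prob_space U\<close> \<open>prob_space \<pi>\<close> sets_\<pi> P_joint'] inv_P
    unfolding R_def[abs_def] by simp_all
  have R_distr: "R x = distr (U \<Otimes>\<^sub>M M) borel (\<lambda>(s, \<omega>). X x (max 0 s) \<omega>)" for x
    unfolding R_def P_def transition_law_def
  proof (rule bind_distr_eq_distr_pair)
    show "(\<lambda>(s, \<omega>). X x (max 0 s) \<omega>) \<in> borel_measurable (U \<Otimes>\<^sub>M M)" by measurable
    have "(\<lambda>s. P (max 0 s) x) \<in> U \<rightarrow>\<^sub>M subprob_algebra borel"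
      using measurable_compose[OF measurable_Pair2'[of x borel U] measurable_prob_algebraD[OF P_joint']] by simp
    then show "(\<lambda>s. distr M borel (X x (max 0 s))) \<in> U \<rightarrow>\<^sub>M subprob_algebra borel"
      by (simp add: P_def transition_law_def)
  qed fact+

  define \<gamma> where "\<gamma> y = v \<bullet> g y" for y
  have \<gamma>_meas [measurable]: "\<gamma> \<in> borel_measurable borel" unfolding \<gamma>_def by measurable
  have \<gamma>_int: "integrable \<pi> \<gamma>" unfolding \<gamma>_def using g by simp
  note R_\<gamma> = invariant_kernel_integral[OF R_kernel sets_\<pi> R_inv \<gamma>_int]
  note R_abs = invariant_kernel_integral[OF R_kernel sets_\<pi> R_inv integrable_abs[OF \<gamma>_int]]

  have displacement: "integrable M (\<lambda>\<omega>. v \<bullet> X x 1 \<omega> - v \<bullet> x)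
      \<and> (\<integral>\<omega>. v \<bullet> X x 1 \<omega> - v \<bullet> x \<partial>M) = (\<integral>y. \<gamma> y \<partial>R x)
      \<and> (\<integral>\<omega>. \<bar>v \<bullet> X x 1 \<omega> - v \<bullet> x\<bar> \<partial>M) \<le> (\<integral>y. \<bar>\<gamma> y\<bar> \<partial>R x) + (\<integral>\<omega>. \<bar>v \<bullet> Z 1 \<omega>\<bar> \<partial>M)"
    if int_R: "integrable (R x) \<gamma>" for x
  proof -
    define W where "W \<omega> = (\<integral>s. \<gamma> (X x (max 0 s) \<omega>) \<partial>U)" for \<omega>
    have int_pair: "integrable (U \<Otimes>\<^sub>M M) (\<lambda>(s, \<omega>). \<gamma> (X x (max 0 s) \<omega>))"
      using int_R unfolding R_distr by (subst (asm) integrable_distr_eq) (auto simp: split_beta')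
    have int_pair_abs: "integrable (U \<Otimes>\<^sub>M M) (\<lambda>(s, \<omega>). \<bar>\<gamma> (X x (max 0 s) \<omega>)\<bar>)"
      using integrable_abs[OF int_pair] by (simp add: split_beta')
    have W_int: "integrable M W"
      unfolding W_def using UM.integrable_snd[OF int_pair] .
    have W_mean: "(\<integral>\<omega>. W \<omega> \<partial>M) = (\<integral>y. \<gamma> y \<partial>R x)"
      unfolding W_def R_distr using UM.integral_snd[OF int_pair]
      by (subst integral_distr) (auto simp: split_beta')
    have "(\<integral>\<omega>. \<bar>W \<omega>\<bar> \<partial>M) \<le> (\<integral>\<omega>. (\<integral>s. \<bar>\<gamma> (X x (max 0 s) \<omega>)\<bar> \<partial>U) \<partial>M)"
    proof (rule integral_mono)
      show "integrable M (\<lambda>\<omega>. \<bar>W \<omega>\<bar>)" using W_int by simp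
      show "integrable M (\<lambda>\<omega>. \<integral>s. \<bar>\<gamma> (X x (max 0 s) \<omega>)\<bar> \<partial>U)"
        using UM.integrable_snd[OF int_pair_abs] .
    qed (simp add: W_def integral_abs_bound)
    also have "\<dots> = (\<integral>y. \<bar>\<gamma> y\<bar> \<partial>R x)"
      unfolding R_distr using UM.integral_snd[OF int_pair_abs]
      by (subst integral_distr) (auto simp: split_beta')
    finally have W_abs: "(\<integral>\<omega>. \<bar>W \<omega>\<bar> \<partial>M) \<le> (\<integral>y. \<bar>\<gamma> y\<bar> \<partial>R x)" .
    have "AE \<omega> in M. \<forall>t\<ge>0. set_integrable lborel {0..t} (\<lambda>s. g (X x s \<omega>)) \<and>
        X x t \<omega> = x + (LINT s:{0..t}|lborel. g (X x s \<omega>)) + Z t \<omega>"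
      using sol unfolding sde_solution_def by simp
    then have AE_eq: "AE \<omega> in M. v \<bullet> X x 1 \<omega> - v \<bullet> x = W \<omega> + v \<bullet> Z 1 \<omega>"
    proof (rule AE_mp, intro AE_I2 impI)
      fix \<omega> assume \<omega>: "\<omega> \<in> space M" and "\<forall>t\<ge>0. set_integrable lborel {0..t} (\<lambda>s. g (X x s \<omega>)) \<and>
        X x t \<omega> = x + (LINT s:{0..t}|lborel. g (X x s \<omega>)) + Z t \<omega>"
      then have int: "set_integrable lborel {0..1} (\<lambda>s. g (X x s \<omega>))"
        and eq: "X x 1 \<omega> = x + (LINT s:{0..1}|lborel. g (X x s \<omega>)) + Z 1 \<omega>"
        by (metis zero_le_one)+
      have [measurable]: "(\<lambda>s. X x (max 0 s) \<omega>) \<in> borel_measurable borel"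
        using measurable_compose[OF measurable_Pair2'[OF \<omega>] X_joint] by simp
      have "W \<omega> = (\<integral>s. indicat_real {0..1} s *\<^sub>R \<gamma> (X x (max 0 s) \<omega>) \<partial>lborel)"
        unfolding W_def U_def by (rule integral_density) auto
      also have "\<dots> = (\<integral>s. v \<bullet> (indicat_real {0..1} s *\<^sub>R g (X x s \<omega>)) \<partial>lborel)"
        by (intro Bochner_Integration.integral_cong) (auto simp: \<gamma>_def indicator_def)
      also have "\<dots> = v \<bullet> (LINT s:{0..1}|lborel. g (X x s \<omega>))"
        using int unfolding set_lebesgue_integral_def set_integrable_def by (rule integral_inner_right)
      finally show "v \<bullet> X x 1 \<omega> - v \<bullet> x = W \<omega> + v \<bullet> Z 1 \<omega>"
        by (simp add: eq inner_add_right)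
    qed
    have [measurable]: "X x 1 \<in> borel_measurable M" "W \<in> borel_measurable M"
      using X_meas[of 1] W_int by auto
    have "integrable M (\<lambda>\<omega>. v \<bullet> X x 1 \<omega> - v \<bullet> x)"
      using W_int Z_int by (subst integrable_cong_AE[OF _ _ AE_eq]) auto
    moreover have "(\<integral>\<omega>. v \<bullet> X x 1 \<omega> - v \<bullet> x \<partial>M) = (\<integral>\<omega>. W \<omega> + v \<bullet> Z 1 \<omega> \<partial>M)"
      by (rule integral_cong_AE[OF _ _ AE_eq]) auto
    moreover have "(\<integral>\<omega>. \<bar>v \<bullet> X x 1 \<omega> - v \<bullet> x\<bar> \<partial>M) \<le> (\<integral>\<omega>. \<bar>W \<omega>\<bar> + \<bar>v \<bullet> Z 1 \<omega>\<bar> \<partial>M)"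
      using AE_eq calculation(1) W_int Z_int by (intro integral_mono_AE) auto
    ultimately show ?thesis
      using W_int Z_int Z_mean W_mean W_abs by simp
  qed

  \<comment> \<open>The mean displacement, from \<open>x\<close> and in unit time, of the truncated coordinate.\<close>
  define D where "D n x = (\<integral>y. truncate n (v \<bullet> y) \<partial>P 1 x) - truncate n (v \<bullet> x)" for n x
  have D_eq: "D n x = (\<integral>\<omega>. truncate n (v \<bullet> X x 1 \<omega>) \<partial>M) - truncate n (v \<bullet> x)" for n x
    unfolding D_def P_def transition_law_def using X_meas[of 1 x] by (subst integral_distr) auto
  have trunc_int: "integrable \<pi> (\<lambda>y. truncate n (v \<bullet> y))" for n
    by (intro \<pi>.integrable_const_bound[of _ "real n"]) (auto simp: abs_truncate_le)
  note P_trunc = invariant_kernel_integral[OF P_kernel[OF zero_le_one] sets_\<pi> inv_P[OF zero_le_one] trunc_int]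
  have D_zero: "(\<integral>x. D n x \<partial>\<pi>) = 0" and D_int: "integrable \<pi> (D n)" for n
    unfolding D_def using P_trunc[of n] trunc_int[of n] by simp_all
  have "(\<lambda>n. \<integral>x. D n x \<partial>\<pi>) \<longlonglongrightarrow> (\<integral>x. (\<integral>y. \<gamma> y \<partial>R x) \<partial>\<pi>)"
  proof (rule integral_dominated_convergence)
    show "(\<lambda>x. \<integral>y. \<gamma> y \<partial>R x) \<in> borel_measurable \<pi>"
      by (rule borel_measurable_integrable[OF R_\<gamma>(2)])
    show "D n \<in> borel_measurable \<pi>" for n by (rule borel_measurable_integrable[OF D_int])
    show "integrable \<pi> (\<lambda>x. (\<integral>y. \<bar>\<gamma> y\<bar> \<partial>R x) + (\<integral>\<omega>. \<bar>v \<bullet> Z 1 \<omega>\<bar> \<partial>M))"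
      using R_abs(2) by simp
    show "AE x in \<pi>. (\<lambda>n. D n x) \<longlonglongrightarrow> (\<integral>y. \<gamma> y \<partial>R x)"
      using R_\<gamma>(1)
    proof eventually_elim
      fix x assume "integrable (R x) \<gamma>"
      note disp = displacement[OF this]
      have "(\<lambda>n. (\<integral>\<omega>. truncate n (v \<bullet> X x 1 \<omega>) \<partial>M) - truncate n (v \<bullet> x)) \<longlonglongrightarrow> (\<integral>\<omega>. v \<bullet> X x 1 \<omega> - v \<bullet> x \<partial>M)"
        using disp X_meas[of 1 x] by (intro truncated_increment \<open>prob_space M\<close>) auto
      then show "(\<lambda>n. D n x) \<longlonglongrightarrow> (\<integral>y. \<gamma> y \<partial>R x)" using disp by (simp add: D_eq)
    qed
    show "AE x in \<pi>. norm (D n x) \<le> (\<integral>y. \<bar>\<gamma> y\<bar> \<partial>R x) + (\<integral>\<omega>. \<bar>v \<bullet> Z 1 \<omega>\<bar> \<partial>M)" for n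
      using R_\<gamma>(1)
    proof eventually_elim
      fix x assume "integrable (R x) \<gamma>"
      note disp = displacement[OF this]
      have "\<bar>D n x\<bar> \<le> (\<integral>\<omega>. \<bar>v \<bullet> X x 1 \<omega> - v \<bullet> x\<bar> \<partial>M)"
        unfolding D_eq using disp X_meas[of 1 x] by (intro truncated_increment \<open>prob_space M\<close>) auto
      then show "norm (D n x) \<le> (\<integral>y. \<bar>\<gamma> y\<bar> \<partial>R x) + (\<integral>\<omega>. \<bar>v \<bullet> Z 1 \<omega>\<bar> \<partial>M)"
        using disp by simp
    qed
  qed
  then have "(\<integral>x. (\<integral>y. \<gamma> y \<partial>R x) \<partial>\<pi>) = 0"
    unfolding D_zero by (simp add: LIMSEQ_const_iff)
  then show ?thesis
    using R_\<gamma>(3) by (simp add: \<gamma>_def)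
qed


section \<open>Convergence in distribution\<close>

lemma prob_outside_ball_small:
  fixes \<nu> :: "'a::euclidean_space measure"
  assumes "prob_space \<nu>" and sets: "sets \<nu> = sets borel" and "0 < \<epsilon>"
  obtains R where "measure \<nu> {y. R < norm (y - x)} < \<epsilon>"
proof -
  interpret prob_space \<nu> by fact
  have [measurable_cong]: "sets \<nu> = sets borel" by fact
  have space: "space \<nu> = UNIV" using sets_eq_imp_space_eq[OF sets] by simp
  let ?B = "\<lambda>n::nat. {y. norm (y - x) \<le> real n}"
  have B: "?B n \<in> sets \<nu>" for n unfolding sets by simp
  have "(\<lambda>n. measure \<nu> (?B n)) \<longlonglongrightarrow> measure \<nu> (\<Union>n. ?B n)"
    using B by (intro finite_Lim_measure_incseq) (auto simp: incseq_def)
  moreover have "(\<Union>n. ?B n) = space \<nu>"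
    unfolding space by (auto intro: real_arch_simple)
  ultimately have "(\<lambda>n. measure \<nu> (?B n)) \<longlonglongrightarrow> 1" by (simp add: prob_space)
  then have "\<forall>\<^sub>F n in sequentially. 1 - \<epsilon> < measure \<nu> (?B n)"
    using \<open>0 < \<epsilon>\<close> by (intro order_tendstoD) auto
  then obtain n where n: "1 - \<epsilon> < measure \<nu> (?B n)"
    by (auto dest: eventually_happens)
  have "{y. real n < norm (y - x)} = space \<nu> - ?B n" unfolding space by auto
  then have "measure \<nu> {y. real n < norm (y - x)} = 1 - measure \<nu> (?B n)"
    using prob_compl[OF B] by simp
  with n show ?thesis by (intro that[of "real n"]) simp
qed

text \<open>
  Slutsky's theorem for processes \<open>V i\<close> that have exactly the limit law. On a large ball, where that
  law has almost all of its mass, the test function is uniformly continuous.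
\<close>
lemma weakly_converges_perturbation:
  fixes Y V :: "'i \<Rightarrow> 'w \<Rightarrow> 'a::euclidean_space"
  assumes "prob_space M" and [measurable]: "\<And>i. Y i \<in> borel_measurable M" "\<And>i. V i \<in> borel_measurable M"
    and V_law: "\<forall>\<^sub>F i in G. distr M borel (V i) = \<nu>"
    and small: "\<And>\<delta>. 0 < \<delta> \<Longrightarrow> ((\<lambda>i. measure M {\<omega> \<in> space M. \<delta> < norm (Y i \<omega> - V i \<omega>)}) \<longlongrightarrow> 0) G"
  shows "weakly_converges (\<lambda>i. distr M borel (Y i)) \<nu> G"
proof (cases "G = bot")
  case True
  then show ?thesis by (simp add: weakly_converges_def)
next
  case False
  interpret prob_space M by fact
  obtain i0 where "distr M borel (V i0) = \<nu>"
    using V_law False by (auto dest: eventually_happens)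
  then have \<nu>: "prob_space \<nu>" "sets \<nu> = sets borel"
    by (auto intro: prob_space_distr)
  show ?thesis
    unfolding weakly_converges_def
  proof (intro allI impI)
    fix f :: "'a \<Rightarrow> real"
    assume cont: "continuous_on UNIV f" and "bounded (range f)"
    then obtain B where B: "0 < B" "\<And>y. \<bar>f y\<bar> \<le> B"
      unfolding bounded_pos by auto
    have [measurable]: "f \<in> borel_measurable borel" by (rule borel_measurable_continuous_onI[OF cont])
    show "((\<lambda>i. \<integral>y. f y \<partial>distr M borel (Y i)) \<longlongrightarrow> (\<integral>y. f y \<partial>\<nu>)) G"
    proof (rule tendstoI)
      fix \<epsilon> :: real assume "0 < \<epsilon>"
      \<comment> \<open>Two exceptional sets of measure less than \<open>e\<close>, on each of which the error is at most \<open>2 * B\<close>.\<close>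
      define e where "e = \<epsilon> / (3 + 4 * B)"
      have e: "0 < e" "e * (1 + 4 * B) < \<epsilon>"
        using \<open>0 < \<epsilon>\<close> B(1) by (auto simp: e_def field_simps)
      obtain R where R: "measure \<nu> {y. R < norm (y - 0)} < e"
        by (rule prob_outside_ball_small[OF \<nu> e(1)])
      have "uniformly_continuous_on (cball 0 (R + 1)) f"
        using cont by (intro compact_uniformly_continuous) (auto intro: continuous_on_subset)
      then obtain d where d: "0 < d" "\<And>y z. y \<in> cball 0 (R + 1) \<Longrightarrow> z \<in> cball 0 (R + 1) \<Longrightarrow>
          dist z y < d \<Longrightarrow> dist (f z) (f y) < e"
        unfolding uniformly_continuous_on_def using e(1) by metis
      define \<delta> where "\<delta> = min (d / 2) 1"
      have \<delta>: "0 < \<delta>" "\<delta> < d" "\<delta> \<le> 1" using d(1) by (auto simp: \<delta>_def)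
      have "\<forall>\<^sub>F i in G. measure M {\<omega> \<in> space M. \<delta> < norm (Y i \<omega> - V i \<omega>)} < e"
        using small[OF \<delta>(1)] e(1) by (rule order_tendstoD)
      with V_law show "\<forall>\<^sub>F i in G. dist (\<integral>y. f y \<partial>distr M borel (Y i)) (\<integral>y. f y \<partial>\<nu>) < \<epsilon>"
      proof eventually_elim
        case (elim i)
        define A1 where "A1 = {\<omega> \<in> space M. \<delta> < norm (Y i \<omega> - V i \<omega>)}"
        define A2 where "A2 = {\<omega> \<in> space M. R < norm (V i \<omega>)}"
        have [measurable, simp]: "A1 \<in> sets M" "A2 \<in> sets M" unfolding A1_def A2_def by measurable
        have A1: "measure M A1 < e" using elim by (simp add: A1_def)
        have "measure M A2 = measure (distr M borel (V i)) {y. R < norm (y - 0)}"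
          by (subst measure_distr) (auto simp: A2_def intro!: arg_cong[where f = "measure M"])
        then have A2: "measure M A2 < e" using R elim by simp
        have int: "integrable M (\<lambda>\<omega>. f (Y i \<omega>))" "integrable M (\<lambda>\<omega>. f (V i \<omega>))"
          using B(2) by (auto intro!: integrable_const_bound[of _ B])
        have "\<bar>f (Y i \<omega>) - f (V i \<omega>)\<bar> \<le> e + 2 * B * indicat_real A1 \<omega> + 2 * B * indicat_real A2 \<omega>"
          if \<omega>: "\<omega> \<in> space M" for \<omega>
        proof (cases "\<omega> \<in> A1 \<or> \<omega> \<in> A2")
          case True
          have "\<bar>f (Y i \<omega>) - f (V i \<omega>)\<bar> \<le> 2 * B"
            using B(2)[of "Y i \<omega>"] B(2)[of "V i \<omega>"] by linarith
          then show ?thesis using True e(1) B(1) by (auto simp: indicator_def)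
        next
          case False
          then have near: "norm (Y i \<omega> - V i \<omega>) \<le> \<delta>" and "norm (V i \<omega>) \<le> R"
            using \<omega> by (auto simp: A1_def A2_def)
          moreover have "norm (Y i \<omega>) \<le> norm (V i \<omega>) + norm (Y i \<omega> - V i \<omega>)"
            using norm_triangle_ineq[of "V i \<omega>" "Y i \<omega> - V i \<omega>"] by simp
          ultimately have "dist (f (Y i \<omega>)) (f (V i \<omega>)) < e"
            using \<delta> by (intro d(2)) (auto simp: dist_norm)
          then show ?thesis using False by (simp add: dist_real_def)
        qed
        moreover have ind: "integrable M (indicat_real A1)" "integrable M (indicat_real A2)"
          by (auto intro!: integrable_real_indicator simp: emeasure_eq_measure)
        ultimately have "(\<integral>\<omega>. \<bar>f (Y i \<omega>) - f (V i \<omega>)\<bar> \<partial>M)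
            \<le> (\<integral>\<omega>. e + 2 * B * indicat_real A1 \<omega> + 2 * B * indicat_real A2 \<omega> \<partial>M)"
          using int by (intro integral_mono) auto
        also have "\<dots> = e + 2 * B * measure M A1 + 2 * B * measure M A2"
          using ind by (simp add: prob_space)
        also have "\<dots> \<le> e + 2 * B * e + 2 * B * e"
          using A1 A2 B(1) by (intro add_mono mult_left_mono) auto
        also have "\<dots> < \<epsilon>" using e(2) by (simp add: algebra_simps)
        finally have "\<bar>\<integral>\<omega>. f (Y i \<omega>) - f (V i \<omega>) \<partial>M\<bar> < \<epsilon>"
          using integral_abs_bound[of M "\<lambda>\<omega>. f (Y i \<omega>) - f (V i \<omega>)"] by linarith
        moreover have "(\<integral>y. f y \<partial>distr M borel (Y i)) = (\<integral>\<omega>. f (Y i \<omega>) \<partial>M)"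
          by (subst integral_distr) auto
        moreover have "(\<integral>y. f y \<partial>\<nu>) = (\<integral>\<omega>. f (V i \<omega>) \<partial>M)"
          unfolding elim(1)[symmetric] by (subst integral_distr) auto
        ultimately show ?case using int by (simp add: dist_real_def)
      qed
    qed
  qed
qed

lemma measure_le_tv_dist:
  assumes "prob_space \<mu>" "prob_space \<nu>" "B \<in> sets borel"
  shows "measure \<mu> B \<le> measure \<nu> B + tv_dist \<mu> \<nu>"
proof -
  interpret \<mu>: prob_space \<mu> by fact
  interpret \<nu>: prob_space \<nu> by fact
  have "\<bar>measure \<mu> A - measure \<nu> A\<bar> \<le> 1" for A
    using \<mu>.prob_le_1[of A] \<nu>.prob_le_1[of A] measure_nonneg[of \<mu> A] measure_nonneg[of \<nu> A] by linarith
  then have "bdd_above ((\<lambda>B. \<bar>measure \<mu> B - measure \<nu> B\<bar>) ` sets borel)" by (auto intro!: bdd_aboveI)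
  then have "\<bar>measure \<mu> B - measure \<nu> B\<bar> \<le> tv_dist \<mu> \<nu>"
    unfolding tv_dist_def using assms(3) by (intro cSUP_upper)
  then show ?thesis by linarith
qed

text \<open>
  The limit law puts little mass outside a large ball, and convergence in total variation is uniform
  over sets, so the sets may vary with \<open>i\<close>.
\<close>
lemma tv_convergent_negligible_at_diverging_scale:
  fixes \<pi> :: "'a::euclidean_space measure"
  assumes \<mu>: "\<forall>\<^sub>F i in G. prob_space (\<mu> i)" and \<pi>: "prob_space \<pi>" "sets \<pi> = sets borel"
    and tv: "((\<lambda>i. tv_dist (\<mu> i) \<pi>) \<longlongrightarrow> 0) G" and r: "filterlim r at_top G"
  shows "((\<lambda>i. measure (\<mu> i) {y. r i < norm (y - x)}) \<longlongrightarrow> 0) G"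
proof (rule tendstoI)
  interpret \<pi>: prob_space \<pi> by fact
  fix \<epsilon> :: real assume "0 < \<epsilon>"
  then have "0 < \<epsilon> / 2" by simp
  obtain R where R: "measure \<pi> {y. R < norm (y - x)} < \<epsilon> / 2"
    by (rule prob_outside_ball_small[OF \<pi> \<open>0 < \<epsilon> / 2\<close>])
  have "\<forall>\<^sub>F i in G. tv_dist (\<mu> i) \<pi> < \<epsilon> / 2"
    using tv \<open>0 < \<epsilon> / 2\<close> by (rule order_tendstoD)
  moreover have "\<forall>\<^sub>F i in G. R \<le> r i" using r by (simp add: filterlim_at_top)
  ultimately show "\<forall>\<^sub>F i in G. dist (measure (\<mu> i) {y. r i < norm (y - x)}) 0 < \<epsilon>"
    using \<mu>
  proof eventually_elim
    case (elim i)
    have "measure (\<mu> i) {y. r i < norm (y - x)} \<le> measure \<pi> {y. r i < norm (y - x)} + tv_dist (\<mu> i) \<pi>"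
      by (rule measure_le_tv_dist) (use elim \<pi> in auto)
    also have "measure \<pi> {y. r i < norm (y - x)} \<le> measure \<pi> {y. R < norm (y - x)}"
      using elim \<pi>(2) by (intro \<pi>.finite_measure_mono) auto
    finally show ?case using R elim by simp
  qed
qed

theorem proposition3p2:
  fixes M :: "'w measure"
    and F :: "real \<Rightarrow> 'w measure"
    and Z :: "real \<Rightarrow> 'w \<Rightarrow> 'a::euclidean_space"
    and X :: "'a \<Rightarrow> real \<Rightarrow> 'w \<Rightarrow> 'a"
    and g :: "'a \<Rightarrow> 'a"
    and \<pi> :: "'a measure"
    and \<alpha> :: real
  assumes "filtered_prob_space M F"
    and "1 < \<alpha>" and "\<alpha> < 2"
    and "rot_inv_stable_process M F \<alpha> Z"
    and "\<And>x. sde_solution M F Z g x (X x)"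
    and "ergodic_with M X \<pi>"
    and "integrable \<pi> g"
  shows "\<forall>x. converges_in_distribution M
           (\<lambda>t \<omega>. t powr (- 1 / \<alpha>) *\<^sub>R
              (LINT s:{0..t}|lborel. g (X x s \<omega>) - (\<integral>y. g y \<partial>\<pi>)))
           (Z 1) at_top"
proof
  fix x
  interpret prob_space M using assms(1) by (simp add: filtered_prob_space_def)
  note Z = assms(4)
  have markov: "markov_process M X" and inv: "invariant_prob (transition_law M X) \<pi>"
    and tv: "((\<lambda>t. tv_dist (transition_law M X t x) \<pi>) \<longlongrightarrow> 0) at_top"
    using assms(6) unfolding ergodic_with_def by auto
  have \<pi>: "prob_space \<pi>" "sets \<pi> = sets borel"
    using inv by (auto simp: invariant_prob_def space_prob_algebra)
  have Z_meas: "Z t \<in> borel_measurable M" if "0 \<le> t" for t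
    by (rule stable_measurable[OF assms(1) Z that])
  have X_meas: "X x t \<in> borel_measurable M" if "0 \<le> t" for t
    using markov that unfolding markov_process_def by simp
  have g_meas [measurable]: "g \<in> borel_measurable borel"
    using borel_measurable_integrable[OF assms(7)] measurable_cong_sets[OF \<pi>(2) refl] by blast
  have sol: "\<forall>\<omega>\<in>space M. cadlag (\<lambda>t. X x t \<omega>)"
    "AE \<omega> in M. \<forall>t\<ge>0. set_integrable lborel {0..t} (\<lambda>s. g (X x s \<omega>)) \<and>
        X x t \<omega> = x + (LINT s:{0..t}|lborel. g (X x s \<omega>)) + Z t \<omega>"
    using assms(5)[of x] unfolding sde_solution_def by simp_all

  \<comment> \<open>With \<open>v = \<pi>(g)\<close> this gives \<open>\<pi>(g) = 0\<close>.\<close>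
  have "v \<bullet> (\<integral>y. g y \<partial>\<pi>) = 0" for v
  proof -
    have "(\<integral>y. v \<bullet> g y \<partial>\<pi>) = 0"
      by (rule stationary_drift_inner_zero[OF prob_space_axioms Z_meas
            stable_integrable_inner[OF assms(1-3) Z] stable_mean_zero[OF assms(1-3) Z]
            assms(5) markov inv assms(7)]) simp
    then show ?thesis using assms(7) by simp
  qed
  from this[of "\<integral>y. g y \<partial>\<pi>"] have drift: "(\<integral>y. g y \<partial>\<pi>) = 0" by simp

  define I where "I t \<omega> = (LINT s:{0..t}|lborel. g (X x s \<omega>))" for t \<omega>
  define Y where "Y t \<omega> = t powr (- 1 / \<alpha>) *\<^sub>R I t \<omega>" for t \<omega>
  \<comment> \<open>\<open>Y t\<close> is the functional of the theorem once the drift is known to be centred; \<open>V t\<close> has the law of \<open>Z 1\<close> when \<open>t > 0\<close>.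
    The cut-off at \<open>0\<close> makes \<open>V t\<close> a random variable for every real \<open>t\<close>.\<close>
  define V where "V t \<omega> = (- (t powr (- 1 / \<alpha>))) *\<^sub>R Z (max 0 t) \<omega>" for t \<omega>
  have X_joint [measurable]: "(\<lambda>(s, \<omega>). X x (max 0 s) \<omega>) \<in> borel_measurable (borel \<Otimes>\<^sub>M M)"
  proof (rule jointly_measurable_if_right_continuous)
    show "X x s \<in> borel_measurable M" if "0 \<le> s" for s by (rule X_meas[OF that])
    show "((\<lambda>r. X x r \<omega>) \<longlongrightarrow> X x s \<omega>) (at_right s)" if "0 \<le> s" "\<omega> \<in> space M" for s \<omega>
      using sol(1) that unfolding cadlag_def by simp
  qed
  have "I t \<in> borel_measurable M" for t
  proof -
    have I_eq: "I t = (\<lambda>\<omega>. \<integral>s. indicat_real {0..t} s *\<^sub>R g (X x (max 0 s) \<omega>) \<partial>lborel)"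
      unfolding I_def set_lebesgue_integral_def
      by (intro ext Bochner_Integration.integral_cong) (auto simp: indicator_def)
    have "(\<lambda>p. X x (max 0 (snd p)) (fst p)) \<in> borel_measurable (M \<Otimes>\<^sub>M lborel)"
      using measurable_compose[OF measurable_pair_swap' X_joint] by (simp add: split_beta' cong: measurable_cong_sets)
    then have [measurable]: "(\<lambda>(\<omega>, s). X x (max 0 s) \<omega>) \<in> borel_measurable (M \<Otimes>\<^sub>M lborel)"
      by (simp add: split_beta')
    show ?thesis unfolding I_eq by measurable
  qed
  then have Y_meas: "Y t \<in> borel_measurable M" for t
    unfolding Y_def by simp
  have V_meas: "V t \<in> borel_measurable M" for t
    unfolding V_def using Z_meas[of "max 0 t"] by simp
  have V_law: "\<forall>\<^sub>F t in at_top. distr M borel (V t) = distr M borel (Z 1)"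
    using eventually_gt_at_top[of 0]
  proof eventually_elim
    case (elim t)
    then show ?case
      using stable_self_similar[OF assms(1) _ assms(3) Z elim, of "- (t powr (- 1 / \<alpha>))"] assms(2)
      by (simp add: V_def[abs_def])
  qed
  have small: "((\<lambda>t. measure M {\<omega> \<in> space M. \<delta> < norm (Y t \<omega> - V t \<omega>)}) \<longlongrightarrow> 0) at_top"
    if "0 < \<delta>" for \<delta>
  proof -
    have scale: "filterlim (\<lambda>t. \<delta> * t powr (1 / \<alpha>)) at_top at_top"
    proof (rule filterlim_tendsto_pos_mult_at_top[OF tendsto_const that])
      show "filterlim (\<lambda>t. t powr (1 / \<alpha>)) at_top at_top"
        using assms(2) by real_asymp
    qed
    have "((\<lambda>t. measure (transition_law M X t x) {y. \<delta> * t powr (1 / \<alpha>) < norm (y - x)}) \<longlongrightarrow> 0) at_top"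
    proof (rule tv_convergent_negligible_at_diverging_scale[OF _ \<pi> tv scale])
      show "\<forall>\<^sub>F t in at_top. prob_space (transition_law M X t x)"
        using eventually_ge_at_top[of 0]
        by eventually_elim (auto simp: transition_law_def intro!: prob_space_distr X_meas)
    qed
    moreover have "\<forall>\<^sub>F t in at_top. measure (transition_law M X t x) {y. \<delta> * t powr (1 / \<alpha>) < norm (y - x)}
        = measure M {\<omega> \<in> space M. \<delta> < norm (Y t \<omega> - V t \<omega>)}"
      using eventually_gt_at_top[of 0]
    proof eventually_elim
      case (elim t)
      have [measurable]: "X x t \<in> borel_measurable M" "Y t \<in> borel_measurable M" "V t \<in> borel_measurable M"
        using X_meas[of t] Y_meas V_meas elim by simp_all
      have "measure (transition_law M X t x) {y. \<delta> * t powr (1 / \<alpha>) < norm (y - x)}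
          = measure M {\<omega> \<in> space M. \<delta> * t powr (1 / \<alpha>) < norm (X x t \<omega> - x)}"
        unfolding transition_law_def using elim X_meas[of t]
        by (subst measure_distr) (auto intro!: arg_cong[where f = "measure M"])
      also have "\<dots> = measure M {\<omega> \<in> space M. \<delta> < norm (Y t \<omega> - V t \<omega>)}"
      proof (rule measure_eq_AE)
        show "AE \<omega> in M. \<omega> \<in> {\<omega> \<in> space M. \<delta> * t powr (1 / \<alpha>) < norm (X x t \<omega> - x)}
            \<longleftrightarrow> \<omega> \<in> {\<omega> \<in> space M. \<delta> < norm (Y t \<omega> - V t \<omega>)}"
          using sol(2)
        proof eventually_elim
          case (elim \<omega>)
          then have "X x t \<omega> - x = I t \<omega> + Z t \<omega>"
            using \<open>0 < t\<close> by (simp add: I_def)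
          then have "Y t \<omega> - V t \<omega> = t powr (- 1 / \<alpha>) *\<^sub>R (X x t \<omega> - x)"
            using \<open>0 < t\<close> by (simp add: Y_def V_def scaleR_add_right)
          then have "norm (Y t \<omega> - V t \<omega>) = norm (X x t \<omega> - x) / t powr (1 / \<alpha>)"
            by (simp add: powr_minus divide_inverse mult.commute)
          then show ?case using \<open>0 < t\<close> by (simp add: pos_less_divide_eq)
        qed
        show "{\<omega> \<in> space M. \<delta> * t powr (1 / \<alpha>) < norm (X x t \<omega> - x)} \<in> sets M"
          by measurable
        show "{\<omega> \<in> space M. \<delta> < norm (Y t \<omega> - V t \<omega>)} \<in> sets M"
          by measurable
      qed
      finally show ?case .
    qed
    ultimately show ?thesis by (rule Lim_transform_eventually)
  qed
  have "weakly_converges (\<lambda>t. distr M borel (Y t)) (distr M borel (Z 1)) at_top"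
    by (rule weakly_converges_perturbation[OF prob_space_axioms Y_meas V_meas V_law small])
  then show "converges_in_distribution M
      (\<lambda>t \<omega>. t powr (- 1 / \<alpha>) *\<^sub>R (LINT s:{0..t}|lborel. g (X x s \<omega>) - (\<integral>y. g y \<partial>\<pi>))) (Z 1) at_top"
    unfolding converges_in_distribution_def drift Y_def I_def by simp
qed

end
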